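(* Let $d\ge1$ be an integer, $a>0$ and $p,q\in(0,1)$, and let $(L_n)_{n\ge0}$ be the delayed elephant random walk on the nonnegative orthant in dimension $d$ with random reinforcement of memory, parametrized by $a,p,q$, as described in the context. Then, as $n\to\infty$, $$\frac1nL_n\to\frac{p}{d(p+q)}\,(1,1,\dots,1)$$ almost surely and in $L^1$, where $(1,\dots,1)\in\mathbb R^d$.
   Context: Let $e_0$ be the zero vector of $\mathbb R^d$ and $e_1,\dots,e_d$ the coordinate vectors. Let $(A_n)_{n\ge1}$ with $A_n=(A_{0n},A_{1n},\dots,A_{dn})$, $(I_n)_{n\ge1}$ and $(J_n)_{n\ge1}$ be three mutually independent i.i.d. sequences such that: the coordinates of $A_n$ are nonnegative and all have the same finite mean $a$ (they may have different distributions and no independence among the coordinates of a single $A_n$ is assumed); $I_n$ takes the values $0,1,\dots,d$ with probabilities $1-p,p/d,\dots,p/d$ respectively; $J_n$ is Bernoulli with $\mathbb P(J_n=1)=1-q$, $\mathbb P(J_n=0)=q$. Independently of these, $U$ is uniform on $\{e_0,e_1,\dots,e_d\}$. The walk has positions $L_0=e_0$ and $L_n=L_{n-1}+X_n$ for $n\ge1$, with steps $X_n\in\{e_0,e_1,\dots,e_d\}$ and $X_1=U$. At each epoch $n\ge1$ there are memories $M_1^{(n)},\dots,M_n^{(n)}$ of the epochs $1,\dots,n$, with $M_1^{(1)}=1$. Let $\mathcal F_n$ be the $\sigma$-field generated by $U$, $(A_m,I_m,J_m)_{m\le n}$ and $(\tau_m)_{2\le m\le n}$, where for $n>1$ the random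 epoch $\tau_n\in\{1,\dots,n-1\}$ satisfies $$\mathbb P(\tau_n=u\mid\mathcal F_{n-1})=\frac{M_u^{(n-1)}}{M_1^{(n-1)}+\cdots+M_{n-1}^{(n-1)}},\qquad u=1,\dots,n-1,$$ and $(A_m,I_m,J_m)_{m\ge n}$ is independent of the $\sigma$-field generated by $\mathcal F_{n-1}$ and $\tau_n$. For $n>1$ the update is as follows. If $X_{\tau_n}=e_i$, $i\in\{0,1,\dots,d\}$, then $M_{\tau_n}^{(n)}=M_{\tau_n}^{(n-1)}+A_{in}$; $M_u^{(n)}=M_u^{(n-1)}$ for $u\in\{1,\dots,n-1\}$, $u\ne\tau_n$; and $M_n^{(n)}=1$. The step is $X_n=e_{I_n}$ if $X_{\tau_n}=e_0$, and $X_n=e_{iJ_n}$ if $X_{\tau_n}=e_i$ with $i\in\{1,\dots,d\}$ (so $X_n=e_i$ if $J_n=1$ and $X_n=e_0$ if $J_n=0$). *)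

theory Defs
  imports "HOL-Probability.Probability"
begin

(* The index set {0, 1, ..., d} is modelled by the type 'd option with d = CARD('d):
   None stands for 0 and the Some i stand for the d coordinates. *)
definition coord_vec :: "'d option \<Rightarrow> real ^ 'd" where
  "coord_vec k = (case k of None \<Rightarrow> 0 | Some i \<Rightarrow> axis i 1)"

definition preimages :: "'w measure \<Rightarrow> ('w \<Rightarrow> 'b) \<Rightarrow> 'b measure \<Rightarrow> 'w set set" where
  "preimages M X N = {X -` B \<inter> space M | B. B \<in> sets N}"

locale derw_randomness = prob_space M for M :: "'w measure" +
  fixes A :: "nat \<Rightarrow> 'w \<Rightarrow> real ^ ('d::finite option)"
    and I :: "nat \<Rightarrow> 'w \<Rightarrow> 'd option"
    and J :: "nat \<Rightarrow> 'w \<Rightarrow> bool"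
    and U :: "'w \<Rightarrow> real ^ 'd"
    and \<tau> :: "nat \<Rightarrow> 'w \<Rightarrow> nat"
begin

definition noise :: "nat \<Rightarrow> 'w set set" where
  "noise m = preimages M (A m) borel \<union> preimages M (I m) (count_space UNIV)
     \<union> preimages M (J m) (count_space UNIV)"

definition history :: "nat \<Rightarrow> 'w measure" where
  "history n = sigma (space M) (preimages M U borel \<union> (\<Union>m\<in>{1..n}. noise m)
     \<union> (\<Union>m\<in>{2..n}. preimages M (\<tau> m) (count_space UNIV)))"

end

(* The sequences are indexed by n >= 1 (and \<tau> by n >= 2); the values of A, I, J, X, Mem and \<tau>
   at other indices are irrelevant. Mem n u is the memory of epoch u at epoch n, for 1 <= u <= n. *)
locale delayed_erw = derw_randomness M A I J U \<tau>
  for M :: "'w measure"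
    and A :: "nat \<Rightarrow> 'w \<Rightarrow> real ^ ('d::finite option)"
    and I :: "nat \<Rightarrow> 'w \<Rightarrow> 'd option"
    and J :: "nat \<Rightarrow> 'w \<Rightarrow> bool"
    and U :: "'w \<Rightarrow> real ^ 'd"
    and \<tau> :: "nat \<Rightarrow> 'w \<Rightarrow> nat" +
  fixes Mem :: "nat \<Rightarrow> nat \<Rightarrow> 'w \<Rightarrow> real"
    and X :: "nat \<Rightarrow> 'w \<Rightarrow> real ^ 'd"
    and L :: "nat \<Rightarrow> 'w \<Rightarrow> real ^ 'd"
    and a p q :: real
  assumes A_indep: "indep_vars (\<lambda>_. borel) A {1..}"
    and A_ident: "n \<ge> 1 \<Longrightarrow> distr M borel (A n) = distr M borel (A 1)"
    and A_nonneg: "n \<ge> 1 \<Longrightarrow> AE \<omega> in M. A n \<omega> $ i \<ge> 0"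
    and A_integrable: "n \<ge> 1 \<Longrightarrow> integrable M (\<lambda>\<omega>. A n \<omega> $ i)"
    and A_mean: "n \<ge> 1 \<Longrightarrow> expectation (\<lambda>\<omega>. A n \<omega> $ i) = a"
    and I_indep: "indep_vars (\<lambda>_. count_space UNIV) I {1..}"
    and I_prob_None: "n \<ge> 1 \<Longrightarrow> prob {\<omega> \<in> space M. I n \<omega> = None} = 1 - p"
    and I_prob_Some: "n \<ge> 1 \<Longrightarrow> prob {\<omega> \<in> space M. I n \<omega> = Some i'} = p / real CARD('d)"
    and J_indep: "indep_vars (\<lambda>_. count_space UNIV) J {1..}"
    and J_prob_True: "n \<ge> 1 \<Longrightarrow> prob {\<omega> \<in> space M. J n \<omega>} = 1 - q"
    and J_prob_False: "n \<ge> 1 \<Longrightarrow> prob {\<omega> \<in> space M. \<not> J n \<omega>} = q"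
    and U_measurable: "random_variable borel U"
    and U_prob: "prob {\<omega> \<in> space M. U \<omega> = coord_vec i} = 1 / (real CARD('d) + 1)"
    and mutually_indep: "indep_sets (\<lambda>k::nat. sigma_sets (space M)
            ([preimages M U borel,
              \<Union>m\<in>{1..}. preimages M (A m) borel,
              \<Union>m\<in>{1..}. preimages M (I m) (count_space UNIV),
              \<Union>m\<in>{1..}. preimages M (J m) (count_space UNIV)] ! k)) {..<4}"
    and \<tau>_measurable: "n > 1 \<Longrightarrow> random_variable (count_space UNIV) (\<tau> n)"
    and \<tau>_range: "n > 1 \<Longrightarrow> \<omega> \<in> space M \<Longrightarrow> \<tau> n \<omega> \<in> {1..n - 1}"
    and \<tau>_cond_prob: "n > 1 \<Longrightarrow> u \<in> {1..n - 1} \<Longrightarrow>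
          AE \<omega> in M. real_cond_exp M (history (n - 1)) (indicator {\<omega>' \<in> space M. \<tau> n \<omega>' = u}) \<omega>
            = Mem (n - 1) u \<omega> / (\<Sum>v = 1..n - 1. Mem (n - 1) v \<omega>)"
    and future_indep: "n > 1 \<Longrightarrow> indep_set
          (sigma_sets (space M) (\<Union>m\<in>{n..}. noise m))
          (sigma_sets (space M)
            (sets (history (n - 1)) \<union> preimages M (\<tau> n) (count_space UNIV)))"
    and L_0: "\<omega> \<in> space M \<Longrightarrow> L 0 \<omega> = coord_vec None"
    and L_step: "n \<ge> 1 \<Longrightarrow> \<omega> \<in> space M \<Longrightarrow> L n \<omega> = L (n - 1) \<omega> + X n \<omega>"
    and X_range: "n \<ge> 1 \<Longrightarrow> \<omega> \<in> space M \<Longrightarrow> X n \<omega> \<in> range coord_vec"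
    and X_1: "\<omega> \<in> space M \<Longrightarrow> X 1 \<omega> = U \<omega>"
    and X_from_rest: "n > 1 \<Longrightarrow> \<omega> \<in> space M \<Longrightarrow> X (\<tau> n \<omega>) \<omega> = coord_vec None \<Longrightarrow>
          X n \<omega> = coord_vec (I n \<omega>)"
    and X_from_move: "n > 1 \<Longrightarrow> \<omega> \<in> space M \<Longrightarrow> X (\<tau> n \<omega>) \<omega> = coord_vec (Some i') \<Longrightarrow>
          X n \<omega> = coord_vec (if J n \<omega> then Some i' else None)"
    and Mem_1: "\<omega> \<in> space M \<Longrightarrow> Mem 1 1 \<omega> = 1"
    and Mem_recalled: "n > 1 \<Longrightarrow> \<omega> \<in> space M \<Longrightarrow> X (\<tau> n \<omega>) \<omega> = coord_vec i \<Longrightarrow>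
          Mem n (\<tau> n \<omega>) \<omega> = Mem (n - 1) (\<tau> n \<omega>) \<omega> + A n \<omega> $ i"
    and Mem_other: "n > 1 \<Longrightarrow> \<omega> \<in> space M \<Longrightarrow> u \<in> {1..n - 1} \<Longrightarrow> u \<noteq> \<tau> n \<omega> \<Longrightarrow>
          Mem n u \<omega> = Mem (n - 1) u \<omega>"
    and Mem_new: "n > 1 \<Longrightarrow> \<omega> \<in> space M \<Longrightarrow> Mem n n \<omega> = 1"

end

theory Submission
  imports Defs "HOL-Library.Discrete_Functions"
begin

text \<open>
  Give every epoch a colour: the index \<open>k\<close> with \<open>X n = coord_vec k\<close>, where \<^term>\<open>None\<close> is rest.
  The memory mass of colour \<open>k\<close> at time \<open>n\<close> is the sum of the memories of the epochs of that colour.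
  The colour recalled at time \<open>n + 1\<close> is then drawn, given the past, in proportion to the masses,
  and it determines in law both the colour of the new epoch and, through \<open>A\<close>, the mass that is
  added. So the masses form a generalised urn, and the walk counts colours.

  Write \<open>r\<close> for the frequency of recalls of colour \<open>k\<close> up to time \<open>n\<close> (\<open>recall_freq\<close>) and \<open>f\<close> for the
  frequency of epochs of colour \<open>k\<close> (\<open>colour_freq\<close>). Almost surely and up to errors that vanish:

  \<^item> \<open>r\<close> is the average over the past of the share of colour \<open>k\<close> in the total mass
    (\<open>recall_freq_share\<close>);
  \<^item> \<open>f\<close> is an affine function of the recall frequencies: a recalled rest leads to colour \<open>k\<close> with the
    probabilities of \<open>I\<close>, a recalled move is repeated with probability \<open>1 - q\<close>
    (\<open>colour_freq_None\<close>, \<open>colour_freq_Some\<close>);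
  \<^item> the mass of colour \<open>k\<close> divided by \<open>n\<close> is \<open>f + a * r\<close> (\<open>mass_average\<close>), and the total mass divided by
    \<open>n\<close> tends to \<open>1 + a\<close> (\<open>total_mass_average\<close>), because each epoch brings one unit of mass and
    each recall \<open>a\<close> units on average.

  Together these say that \<open>r\<close> is, up to a vanishing error, the average of \<open>c * r + b\<close> over the past,
  with constants \<open>c\<close> and \<open>b\<close>. For rest \<open>c = (1 - p - q + a) / (1 + a)\<close> and \<open>b = q / (1 + a)\<close>; once the rest
  frequency is known to converge, a coordinate has \<open>c = (1 - q + a) / (1 + a)\<close>. In both cases
  \<open>\<bar>c\<bar> < 1\<close>, and averaging does not increase the limit superior of the absolute value, so the distance
  of \<open>r\<close> from the fixed point \<open>b / (1 - c)\<close> has limit superior at most \<open>\<bar>c\<bar>\<close> times itself, that is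
  zero (\<open>average_fixed_point\<close>).
  The frequencies of the coordinates, which are the coordinates of \<open>L n / n\<close>, follow. Since
  \<open>norm (L n) \<le> n\<close>, convergence in mean is dominated convergence.

  The error terms are averages of uncorrelated increments. Bounded ones obey a strong law by second
  moments along the squares (\<open>bounded_uncorrelated_SLLN\<close>). The reinforcements only have a first moment.
  They are cut at a level \<open>K\<close>: the bounded part obeys the same law, and the excess over \<open>K\<close> contributes at
  most a multiple of its mean (\<open>pairwise_iid_sum_bound\<close>), which is small for large \<open>K\<close>.
\<close>

section \<open>Averages of real sequences\<close>

text \<open>
  Between \<open>j\<^sup>2\<close> and \<open>(j + 1)\<^sup>2\<close> there are only \<open>2 * j\<close> integers, so a sum of bounded terms moves by \<open>O(j)\<close>,
  which is negligible against \<open>j\<^sup>2\<close>.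
\<close>

lemma average_along_squares:
  fixes f :: "nat \<Rightarrow> real"
  assumes bound: "\<And>m. k \<le> m \<Longrightarrow> \<bar>f m\<bar> \<le> C"
    and squares: "(\<lambda>j. (\<Sum>m=k..j\<^sup>2. f m) / real (j\<^sup>2)) \<longlonglongrightarrow> 0"
  shows "(\<lambda>n. (\<Sum>m=k..n. f m) / real n) \<longlonglongrightarrow> 0"
proof -
  have C: "0 \<le> C" using bound[of k] by (auto intro: order_trans[OF abs_ge_zero])
  define S where "S n = (\<Sum>m=k..n. f m)" for n
  have gap: "\<bar>S n - S l\<bar> \<le> C * real (n - l)" if "l \<le> n" for l n
    using that
  proof (induction n rule: dec_induct)
    case (step n)
    have "\<bar>S (Suc n) - S n\<bar> \<le> C"
      using bound[of "Suc n"] C by (cases "k \<le> Suc n") (auto simp: S_def)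
    then show ?case using step by (simp add: Suc_diff_le algebra_simps)
  qed simp
  have S_le: "\<bar>S n / real n\<bar> \<le> \<bar>S ((floor_sqrt n)\<^sup>2) / real ((floor_sqrt n)\<^sup>2)\<bar> + 2 * C / real (floor_sqrt n)"
    if n: "0 < n" for n
  proof -
    define j where "j = floor_sqrt n"
    have j: "0 < j" "j\<^sup>2 \<le> n" "n - j\<^sup>2 \<le> 2 * j"
      using n Suc_floor_sqrt_power2_gt[of n] floor_sqrt_power2_le[of n]
      by (auto simp: j_def power2_eq_square simp del: floor_sqrt_power2_le)
    have j2: "0 < real (j\<^sup>2)" "real (j\<^sup>2) \<le> real n" using j by simp_all
    have "\<bar>S n\<bar> \<le> \<bar>S (j\<^sup>2)\<bar> + C * real (n - j\<^sup>2)"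
      using gap[OF j(2)] by linarith
    also have "C * real (n - j\<^sup>2) \<le> C * (2 * real j)"
      using j(3) C by (intro mult_left_mono) linarith+
    finally have "\<bar>S n / real n\<bar> \<le> (\<bar>S (j\<^sup>2)\<bar> + C * (2 * real j)) / real n"
      by (simp add: divide_right_mono)
    also have "\<dots> \<le> (\<bar>S (j\<^sup>2)\<bar> + C * (2 * real j)) / real (j\<^sup>2)"
      proof (rule divide_left_mono)
      show "0 < real n * real (j\<^sup>2)" using j2 n by (intro mult_pos_pos) simp_all
    qed (use j2 C in auto)
    also have "\<dots> = \<bar>S (j\<^sup>2) / real (j\<^sup>2)\<bar> + 2 * C / real j"
      using j(1) by (simp add: add_divide_distrib power2_eq_square)
    finally show ?thesis by (simp add: j_def)
  qed
  have fs: "filterlim floor_sqrt at_top at_top"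
    unfolding filterlim_at_top
  proof
    fix j show "\<forall>\<^sub>F n in sequentially. j \<le> floor_sqrt n"
      using eventually_ge_at_top[of "j\<^sup>2"] by eventually_elim (rule le_floor_sqrtI)
  qed
  have "(\<lambda>j. \<bar>S (j\<^sup>2) / real (j\<^sup>2)\<bar> + 2 * C / real j) \<longlonglongrightarrow> \<bar>0\<bar> + 0"
    unfolding S_def by (intro tendsto_add tendsto_rabs squares lim_const_over_n)
  from filterlim_compose[OF this fs]
  have "(\<lambda>n. \<bar>S ((floor_sqrt n)\<^sup>2) / real ((floor_sqrt n)\<^sup>2)\<bar> + 2 * C / real (floor_sqrt n)) \<longlonglongrightarrow> 0"
    by simp
  moreover have "\<forall>\<^sub>F n in sequentially. norm (S n / real n)
      \<le> \<bar>S ((floor_sqrt n)\<^sup>2) / real ((floor_sqrt n)\<^sup>2)\<bar> + 2 * C / real (floor_sqrt n)"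
    using eventually_gt_at_top[of 0] by eventually_elim (use S_le in simp)
  ultimately show ?thesis
    unfolding S_def[symmetric] by (rule Lim_null_comparison[rotated])
qed

lemma eventually_average_le:
  fixes s :: "nat \<Rightarrow> real"
  assumes "eventually (\<lambda>n. \<bar>s n\<bar> \<le> b) sequentially" and "0 < e" "0 \<le> b"
  shows "eventually (\<lambda>n. \<bar>(\<Sum>m=1..n. s m) / real n\<bar> \<le> b + e) sequentially"
proof -
  obtain N where N: "\<And>n. N \<le> n \<Longrightarrow> \<bar>s n\<bar> \<le> b"
    using assms(1) by (auto simp: eventually_sequentially)
  define H where "H = (\<Sum>m=1..N. \<bar>s m\<bar>)"
  have bound: "\<bar>\<Sum>m=1..n. s m\<bar> \<le> H + b * real n" for n
  proof -
    have "\<bar>\<Sum>m=1..n. s m\<bar> \<le> (\<Sum>m=1..n. \<bar>s m\<bar>)" by (rule sum_abs)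
    also have "\<dots> \<le> (\<Sum>m=1..n. (if m \<le> N then \<bar>s m\<bar> else 0) + b)"
      using N \<open>0 \<le> b\<close> by (intro sum_mono) (auto simp: not_le intro: N)
    also have "\<dots> = (\<Sum>m\<in>{1..n} \<inter> {m. m \<le> N}. \<bar>s m\<bar>) + b * real n"
      by (simp add: sum.distrib sum.If_cases)
    also have "(\<Sum>m\<in>{1..n} \<inter> {m. m \<le> N}. \<bar>s m\<bar>) \<le> H"
      unfolding H_def by (intro sum_mono2) auto
    finally show ?thesis by simp
  qed
  have "((\<lambda>n. H / real n) \<longlongrightarrow> 0) sequentially"
    by (rule lim_const_over_n)
  then have "eventually (\<lambda>n. H / real n < e) sequentially"
    using \<open>0 < e\<close> by (rule order_tendstoD)
  then show ?thesis
    using eventually_gt_at_top[of 0]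
  proof eventually_elim
    case (elim n)
    then show ?case
      using bound[of n] by (simp add: field_simps)
  qed
qed

text \<open>
  If \<open>\<bar>s\<bar>\<close> is eventually at most \<open>b\<close>, so are its averages up to a small error, hence \<open>\<bar>s\<bar>\<close> is eventually at
  most \<open>\<bar>c\<bar> * b\<close> up to a small error. Iterating this improvement brings the bound below any positive number.
\<close>

lemma average_contraction:
  fixes s :: "nat \<Rightarrow> real"
  assumes bounded: "\<And>n. \<bar>s n\<bar> \<le> B" and c: "\<bar>c\<bar> < 1"
    and rec: "(\<lambda>n. s n - c * ((\<Sum>m=1..n. s m) / real n)) \<longlonglongrightarrow> 0"
  shows "s \<longlonglongrightarrow> 0"
proof (rule LIMSEQ_I)
  fix r :: real assume r: "0 < r"
  \<comment> \<open>This makes \<open>r / 2\<close> the fixed point of \<open>b \<mapsto> \<bar>c\<bar> * b + 2 * e\<close>.\<close>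
  define e where "e = r * (1 - \<bar>c\<bar>) / 4"
  have e: "0 < e" using r c by (simp add: e_def)
  have B: "0 \<le> B" using bounded[of 0] by linarith
  have step: "eventually (\<lambda>n. \<bar>s n\<bar> \<le> \<bar>c\<bar> * b + 2 * e) sequentially"
    if b: "eventually (\<lambda>n. \<bar>s n\<bar> \<le> b) sequentially" "0 \<le> b" for b
  proof -
    have "eventually (\<lambda>n. \<bar>s n - c * ((\<Sum>m=1..n. s m) / real n)\<bar> < e) sequentially"
      using tendstoD[OF rec e] by (simp add: dist_real_def)
    then show ?thesis
      using eventually_average_le[OF b(1) e b(2)]
    proof eventually_elim
      case (elim n)
      let ?a = "(\<Sum>m=1..n. s m) / real n"
      have "\<bar>c * ?a\<bar> \<le> \<bar>c\<bar> * (b + e)"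
        unfolding abs_mult using elim(2) by (intro mult_left_mono) auto
      also have "\<dots> \<le> \<bar>c\<bar> * b + e"
        using c e by (simp add: distrib_left)
      finally have "\<bar>c * ?a\<bar> \<le> \<bar>c\<bar> * b + e" .
      moreover have "\<bar>s n\<bar> \<le> \<bar>s n - c * ?a\<bar> + \<bar>c * ?a\<bar>"
        using abs_triangle_ineq[of "s n - c * ?a" "c * ?a"] by simp
      ultimately have "\<bar>s n\<bar> \<le> \<bar>s n - c * ?a\<bar> + (\<bar>c\<bar> * b + e)"
        by (meson add_left_mono order_trans)
      also have "\<dots> \<le> e + (\<bar>c\<bar> * b + e)"
        using elim(1) by (intro add_right_mono) simp
      finally show ?case by simp
    qed
  qed
  have iter: "eventually (\<lambda>n. \<bar>s n\<bar> \<le> \<bar>c\<bar> ^ j * B + r / 2) sequentially" for j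
  proof (induction j)
    case 0
    then show ?case using bounded r by (auto intro!: always_eventually add_increasing2)
  next
    case (Suc j)
    have "\<bar>c\<bar> * (\<bar>c\<bar> ^ j * B + r / 2) + 2 * e = \<bar>c\<bar> ^ Suc j * B + r / 2"
      by (simp add: e_def field_simps)
    then show ?case using step[OF Suc] B r by simp
  qed
  have "(\<lambda>j. \<bar>c\<bar> ^ j * B) \<longlonglongrightarrow> 0 * B"
    using c by (intro tendsto_intros) (simp add: LIMSEQ_power_zero)
  then have "eventually (\<lambda>j. \<bar>c\<bar> ^ j * B < r / 2) sequentially"
    by (rule order_tendstoD(2)) (use r in simp)
  then obtain j where "\<bar>c\<bar> ^ j * B < r / 2"
    by (auto simp: eventually_sequentially)
  then have "eventually (\<lambda>n. \<bar>s n\<bar> < r) sequentially"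
    using iter[of j]
  proof (elim eventually_mono)
    fix n
    assume "\<bar>s n\<bar> \<le> \<bar>c\<bar> ^ j * B + r / 2" "\<bar>c\<bar> ^ j * B < r / 2"
    then show "\<bar>s n\<bar> < r" by linarith
  qed
  then show "\<exists>no. \<forall>n\<ge>no. norm (s n - 0) < r"
    by (simp add: eventually_sequentially)
qed

lemma average_tendsto_0:
  fixes s :: "nat \<Rightarrow> real"
  assumes "s \<longlonglongrightarrow> 0"
  shows "(\<lambda>n. (\<Sum>m=1..n. s m) / real n) \<longlonglongrightarrow> 0"
proof (rule tendstoI)
  fix e :: real assume e: "0 < e"
  have "eventually (\<lambda>n. \<bar>s n\<bar> \<le> e / 3) sequentially"
    using tendstoD[OF assms, of "e / 3"] e by (auto elim!: eventually_mono)
  then have "eventually (\<lambda>n. \<bar>(\<Sum>m=1..n. s m) / real n\<bar> \<le> e / 3 + e / 3) sequentially"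
    using e by (intro eventually_average_le) auto
  then show "eventually (\<lambda>n. dist ((\<Sum>m=1..n. s m) / real n) 0 < e) sequentially"
  proof eventually_elim
    case (elim n)
    then have "\<bar>(\<Sum>m=1..n. s m) / real n\<bar> < e" using e by linarith
    then show ?case by (simp add: dist_real_def)
  qed
qed

text \<open>
  In the application \<open>r n\<close> is the frequency of recalls of a colour and \<open>y n\<close> is the share of this colour in the
  memory after \<open>n\<close> epochs. The deviation of \<open>r\<close> from the fixed point of \<open>x \<mapsto> c * x + b\<close> satisfies the
  homogeneous recursion of \<open>average_contraction\<close>.
\<close>

lemma average_fixed_point:
  fixes r y :: "nat \<Rightarrow> real"
  assumes bounded: "\<And>n. \<bar>r n\<bar> \<le> B" and c: "\<bar>c\<bar> < 1"
    and drift: "(\<lambda>n. y n - (c * r n + b)) \<longlonglongrightarrow> 0"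
    and avg: "(\<lambda>n. r n - (\<Sum>m=2..n. y (m - 1)) / real n) \<longlonglongrightarrow> 0"
  shows "r \<longlonglongrightarrow> b / (1 - c)"
proof -
  define \<rho> where "\<rho> = b / (1 - c)"
  have \<rho>: "c * \<rho> + b = \<rho>" using c by (simp add: \<rho>_def field_simps)
  define s where "s n = r n - \<rho>" for n
  define x where "x n = y n - (c * r n + b)" for n
  have shift: "(\<Sum>m=2..n. y (m - 1)) = (\<Sum>m=1..n. y m) - y n" if "0 < n" for n
    using that by (induction n rule: nat_induct_non_zero) (auto simp: sum.cl_ivl_Suc)
  have eq: "s n - c * ((\<Sum>m=1..n. s m) / real n)
      = (r n - (\<Sum>m=2..n. y (m - 1)) / real n) + (\<Sum>m=1..n. x m) / real n
        - x n / real n - (c * r n + b) / real n" if "0 < n" for n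
  proof -
    have "y m = x m + c * s m + \<rho>" for m
      using \<rho> by (simp add: x_def s_def algebra_simps)
    then have "(\<Sum>m=1..n. y m) = (\<Sum>m=1..n. x m) + c * (\<Sum>m=1..n. s m) + \<rho> * real n"
      by (simp add: sum.distrib sum_distrib_left)
    then have "(\<Sum>m=2..n. y (m - 1)) / real n = (\<Sum>m=1..n. x m) / real n
        + c * ((\<Sum>m=1..n. s m) / real n) + \<rho> - y n / real n"
      using that by (simp only: shift[OF that] add_divide_distrib diff_divide_distrib) simp
    moreover have "y n / real n = x n / real n + (c * r n + b) / real n"
      by (simp add: x_def diff_divide_distrib)
    ultimately show ?thesis by (simp add: s_def)
  qed
  have x: "x \<longlonglongrightarrow> 0" using drift by (simp add: x_def[abs_def])
  have "(\<lambda>n. (c * r n + b) / real n) \<longlonglongrightarrow> 0"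
  proof (rule Lim_null_comparison)
    show "\<forall>\<^sub>F n in sequentially. norm ((c * r n + b) / real n) \<le> (B + \<bar>b\<bar>) / real n"
    proof (intro always_eventually allI)
      fix n
      have "\<bar>c * r n\<bar> \<le> 1 * B"
        unfolding abs_mult using c bounded[of n] by (intro mult_mono) auto
      then show "norm ((c * r n + b) / real n) \<le> (B + \<bar>b\<bar>) / real n"
        by (auto intro!: divide_right_mono)
    qed
  qed (rule lim_const_over_n)
  moreover have "(\<lambda>n. x n / real n) \<longlonglongrightarrow> 0"
    using tendsto_mult[OF x lim_1_over_n] by simp
  ultimately have "(\<lambda>n. (r n - (\<Sum>m=2..n. y (m - 1)) / real n) + (\<Sum>m=1..n. x m) / real n
        - x n / real n - (c * r n + b) / real n) \<longlonglongrightarrow> 0 + 0 - 0 - 0"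
    by (intro tendsto_diff tendsto_add avg average_tendsto_0 x)
  then have "(\<lambda>n. s n - c * ((\<Sum>m=1..n. s m) / real n)) \<longlonglongrightarrow> 0 + 0 - 0 - 0"
  proof (rule Lim_transform_eventually)
    show "\<forall>\<^sub>F n in sequentially. (r n - (\<Sum>m=2..n. y (m - 1)) / real n) + (\<Sum>m=1..n. x m) / real n
        - x n / real n - (c * r n + b) / real n = s n - c * ((\<Sum>m=1..n. s m) / real n)"
      using eventually_gt_at_top[of "0::nat"]
    proof (rule eventually_mono)
      fix n :: nat assume "0 < n"
      from eq[OF this, symmetric]
      show "(r n - (\<Sum>m=2..n. y (m - 1)) / real n) + (\<Sum>m=1..n. x m) / real n
        - x n / real n - (c * r n + b) / real n = s n - c * ((\<Sum>m=1..n. s m) / real n)" .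
    qed
  qed
  then have contraction: "(\<lambda>n. s n - c * ((\<Sum>m=1..n. s m) / real n)) \<longlonglongrightarrow> 0"
    by simp
  have s_bound: "\<bar>s n\<bar> \<le> B + \<bar>\<rho>\<bar>" for n
    using bounded[of n] by (simp add: s_def)
  have "s \<longlonglongrightarrow> 0" by (rule average_contraction[OF s_bound c contraction])
  then show ?thesis unfolding s_def \<rho>_def[symmetric] by (rule LIM_zero_cancel)
qed

lemma tendsto_0_cong_from_1:
  fixes f g :: "nat \<Rightarrow> real"
  assumes "f \<longlonglongrightarrow> 0" and "\<And>n. 1 \<le> n \<Longrightarrow> g n = f n"
  shows "g \<longlonglongrightarrow> 0"
  using assms(1)
proof (rule Lim_transform_eventually)
  show "\<forall>\<^sub>F n in sequentially. f n = g n"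
    using eventually_ge_at_top[of "1 :: nat"] by eventually_elim (simp add: assms(2))
qed

lemma tendsto_divide_approx:
  fixes x b s :: "nat \<Rightarrow> real"
  assumes approx: "(\<lambda>n. x n - b n) \<longlonglongrightarrow> 0" and bounded: "\<And>n. \<bar>b n\<bar> \<le> C"
    and s: "s \<longlonglongrightarrow> l" and l: "l \<noteq> 0"
  shows "(\<lambda>n. x n / s n - b n / l) \<longlonglongrightarrow> 0"
proof -
  have inv: "(\<lambda>n. inverse (s n)) \<longlonglongrightarrow> inverse l"
    by (rule tendsto_inverse[OF s l])
  then have d: "(\<lambda>n. inverse (s n) - inverse l) \<longlonglongrightarrow> 0" by (rule LIM_zero)
  have "(\<lambda>n. b n * (inverse (s n) - inverse l)) \<longlonglongrightarrow> 0"
  proof (rule Lim_null_comparison)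
    show "\<forall>\<^sub>F n in sequentially. norm (b n * (inverse (s n) - inverse l)) \<le> C * \<bar>inverse (s n) - inverse l\<bar>"
      using bounded by (intro always_eventually allI) (simp add: abs_mult mult_right_mono)
    show "(\<lambda>n. C * \<bar>inverse (s n) - inverse l\<bar>) \<longlonglongrightarrow> 0"
      using tendsto_mult[OF tendsto_const[of C] tendsto_rabs[OF d]] by simp
  qed
  from tendsto_add[OF tendsto_mult[OF approx inv] this]
  have "(\<lambda>n. (x n - b n) * inverse (s n) + b n * (inverse (s n) - inverse l)) \<longlonglongrightarrow> 0" by simp
  moreover have "(x n - b n) * inverse (s n) + b n * (inverse (s n) - inverse l) = x n / s n - b n / l" for n
    by (simp add: divide_inverse algebra_simps)
  ultimately show ?thesis by simp
qed

lemma affine_divide: "(x * r + y) / z = x / z * r + y / z" for x r y z :: real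
  by (simp add: add_divide_distrib)

lemma sum_from_1: "1 \<le> n \<Longrightarrow> (\<Sum>m=1..n. f m) = f 1 + (\<Sum>m=2..n. f m)" for f :: "nat \<Rightarrow> real"
  by (simp add: sum.atLeast_Suc_atMost numeral_2_eq_2)

section \<open>A strong law for bounded uncorrelated variables\<close>

context prob_space
begin

lemma AE_tendsto_0_summable_expectation:
  fixes f :: "nat \<Rightarrow> 'a \<Rightarrow> real"
  assumes [measurable]: "\<And>j. integrable M (f j)" and nonneg: "\<And>j x. 0 \<le> f j x"
    and "summable (\<lambda>j. expectation (f j))"
  shows "AE x in M. (\<lambda>j. f j x) \<longlonglongrightarrow> 0"
proof -
  have "(\<integral>\<^sup>+x. (\<Sum>j. ennreal (f j x)) \<partial>M) = (\<Sum>j. \<integral>\<^sup>+x. ennreal (f j x) \<partial>M)"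
    by (intro nn_integral_suminf) simp
  also have "\<dots> = (\<Sum>j. ennreal (expectation (f j)))"
    using nonneg by (simp add: nn_integral_eq_integral assms(1))
  also have "\<dots> = ennreal (\<Sum>j. expectation (f j))"
    using nonneg assms(3) by (intro suminf_ennreal2) auto
  finally have "(\<integral>\<^sup>+x. (\<Sum>j. ennreal (f j x)) \<partial>M) \<noteq> \<infinity>" by simp
  then have "AE x in M. (\<Sum>j. ennreal (f j x)) \<noteq> \<infinity>"
    by (intro nn_integral_PInf_AE) measurable
  then show ?thesis
  proof eventually_elim
    case (elim x)
    then have "summable (\<lambda>j. f j x)"
      using nonneg by (intro summable_suminf_not_top) auto
    then show ?case by (rule summable_LIMSEQ_zero)
  qed
qed

lemma expectation_square_uncorrelated_sum:
  fixes D :: "nat \<Rightarrow> 'a \<Rightarrow> real"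
  assumes fin: "finite F"
    and int: "\<And>l m. l \<in> F \<Longrightarrow> m \<in> F \<Longrightarrow> integrable M (\<lambda>x. D l x * D m x)"
    and uncorr: "\<And>l m. l \<in> F \<Longrightarrow> m \<in> F \<Longrightarrow> l < m \<Longrightarrow> expectation (\<lambda>x. D l x * D m x) = 0"
  shows "integrable M (\<lambda>x. (\<Sum>m\<in>F. D m x)\<^sup>2)"
    and "expectation (\<lambda>x. (\<Sum>m\<in>F. D m x)\<^sup>2) = (\<Sum>m\<in>F. expectation (\<lambda>x. (D m x)\<^sup>2))"
proof -
  have sq: "(\<Sum>m\<in>F. D m x)\<^sup>2 = (\<Sum>l\<in>F. \<Sum>m\<in>F. D l x * D m x)" for x
    by (simp add: power2_eq_square sum_product)
  show "integrable M (\<lambda>x. (\<Sum>m\<in>F. D m x)\<^sup>2)"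
    unfolding sq by (intro Bochner_Integration.integrable_sum int)
  have off: "expectation (\<lambda>x. D l x * D m x) = 0" if "l \<in> F" "m \<in> F" "l \<noteq> m" for l m
    using uncorr[of l m] uncorr[of m l] that by (cases "l < m") (auto simp: mult.commute)
  have "expectation (\<lambda>x. (\<Sum>m\<in>F. D m x)\<^sup>2) = (\<Sum>l\<in>F. \<Sum>m\<in>F. expectation (\<lambda>x. D l x * D m x))"
    unfolding sq by (subst Bochner_Integration.integral_sum)
      (auto intro!: Bochner_Integration.integrable_sum int sum.cong Bochner_Integration.integral_sum)
  also have "\<dots> = (\<Sum>l\<in>F. \<Sum>m\<in>F. if m = l then expectation (\<lambda>x. (D l x)\<^sup>2) else 0)"
    by (intro sum.cong refl) (auto simp: off power2_eq_square)
  also have "\<dots> = (\<Sum>m\<in>F. expectation (\<lambda>x. (D m x)\<^sup>2))"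
    using fin by simp
  finally show "expectation (\<lambda>x. (\<Sum>m\<in>F. D m x)\<^sup>2) = (\<Sum>m\<in>F. expectation (\<lambda>x. (D m x)\<^sup>2))" .
qed

text \<open>
  The second moment of the average of the first \<open>n\<close> terms is of order \<open>1 / n\<close>. This is summable along the
  squares, which gives almost sure convergence there, and bounded terms cannot leave the limit between squares.
\<close>

lemma bounded_uncorrelated_SLLN:
  fixes D :: "nat \<Rightarrow> 'a \<Rightarrow> real"
  assumes meas: "\<And>m. k \<le> m \<Longrightarrow> D m \<in> borel_measurable M"
    and bound: "\<And>m. k \<le> m \<Longrightarrow> AE x in M. \<bar>D m x\<bar> \<le> C"
    and uncorr: "\<And>l m. k \<le> l \<Longrightarrow> l < m \<Longrightarrow> expectation (\<lambda>x. D l x * D m x) = 0"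
  shows "AE x in M. (\<lambda>n. (\<Sum>m=k..n. D m x) / real n) \<longlonglongrightarrow> 0"
proof -
  have int: "integrable M (\<lambda>x. D l x * D m x)" if "k \<le> l" "k \<le> m" for l m
  proof (rule integrable_const_bound)
    show "AE x in M. norm (D l x * D m x) \<le> C * C"
      using bound[OF that(1)] bound[OF that(2)]
      by eventually_elim (auto simp: abs_mult intro!: mult_mono)
    show "(\<lambda>x. D l x * D m x) \<in> borel_measurable M"
      using meas[OF that(1)] meas[OF that(2)] by measurable
  qed
  have sq_le: "expectation (\<lambda>x. (D m x)\<^sup>2) \<le> C\<^sup>2" if "k \<le> m" for m
  proof (rule integral_le_const)
    show "integrable M (\<lambda>x. (D m x)\<^sup>2)" using int[OF that that] by (simp add: power2_eq_square)
    show "AE x in M. (D m x)\<^sup>2 \<le> C\<^sup>2"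
      using bound[OF that] by eventually_elim (metis abs_ge_zero power2_abs power_mono)
  qed
  \<comment> \<open>Squared averages along the squares.\<close>
  define Q where "Q j x = ((\<Sum>m=k..j\<^sup>2. D m x) / real (j\<^sup>2))\<^sup>2" for j x
  have Q_int: "integrable M (Q j)" for j
    unfolding Q_def power_divide
    by (intro integrable_divide expectation_square_uncorrelated_sum(1) int uncorr) auto
  have Q_le: "expectation (Q j) \<le> 2 * C\<^sup>2 * inverse (real j ^ 2)" for j
  proof (cases "j = 0")
    case False
    have "expectation (Q j) = (\<Sum>m=k..j\<^sup>2. expectation (\<lambda>x. (D m x)\<^sup>2)) / (real (j\<^sup>2))\<^sup>2"
    proof -
      have "expectation (\<lambda>x. (\<Sum>m=k..j\<^sup>2. D m x)\<^sup>2) = (\<Sum>m=k..j\<^sup>2. expectation (\<lambda>x. (D m x)\<^sup>2))"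
        by (rule expectation_square_uncorrelated_sum(2)) (auto intro: int uncorr)
      then show ?thesis by (simp add: Q_def[abs_def] power_divide)
    qed
    also have "\<dots> \<le> (\<Sum>m=k..j\<^sup>2. C\<^sup>2) / (real (j\<^sup>2))\<^sup>2"
      using sq_le by (intro divide_right_mono sum_mono) auto
    also have "\<dots> \<le> (2 * real (j\<^sup>2) * C\<^sup>2) / (real (j\<^sup>2))\<^sup>2"
    proof (intro divide_right_mono)
      have "Suc (j\<^sup>2) - k \<le> 2 * j\<^sup>2" using False by (simp add: Suc_le_eq le_diff_conv)
      then have "real (Suc (j\<^sup>2) - k) \<le> real (2 * j\<^sup>2)" by (rule of_nat_mono)
      then show "(\<Sum>m=k..j\<^sup>2. C\<^sup>2) \<le> 2 * real (j\<^sup>2) * C\<^sup>2"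
        by (simp add: mult_right_mono)
    qed simp
    also have "\<dots> = 2 * C\<^sup>2 * inverse (real j ^ 2)"
      using False by (simp add: field_simps power2_eq_square)
    finally show ?thesis .
  qed (simp add: Q_def[abs_def])
  have "summable (\<lambda>j. expectation (Q j))"
  proof (rule summable_comparison_test')
    show "summable (\<lambda>j. 2 * C\<^sup>2 * inverse (real j ^ 2))"
      by (intro summable_mult inverse_power_summable) simp
    show "norm (expectation (Q j)) \<le> 2 * C\<^sup>2 * inverse (real j ^ 2)" if "0 \<le> j" for j
    proof -
      have "0 \<le> expectation (Q j)" by (intro Bochner_Integration.integral_nonneg) (simp add: Q_def)
      then show ?thesis using Q_le[of j] by simp
    qed
  qed
  then have "AE x in M. (\<lambda>j. Q j x) \<longlonglongrightarrow> 0"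
    by (rule AE_tendsto_0_summable_expectation[OF Q_int, rotated]) (simp add: Q_def)
  moreover have "AE x in M. \<forall>m. k \<le> m \<longrightarrow> \<bar>D m x\<bar> \<le> C"
    using bound by (subst AE_all_countable) auto
  ultimately show ?thesis
  proof eventually_elim
    case (elim x)
    have "(\<lambda>j. sqrt (Q j x)) \<longlonglongrightarrow> sqrt 0"
      using elim(1) by (rule tendsto_real_sqrt)
    then have "(\<lambda>j. (\<Sum>m=k..j\<^sup>2. D m x) / real (j\<^sup>2)) \<longlonglongrightarrow> 0"
      unfolding Q_def by (simp only: real_sqrt_abs real_sqrt_zero tendsto_rabs_zero_iff)
    then show ?case
      using elim(2) by (intro average_along_squares) auto
  qed
qed

end

section \<open>A linear bound for sums of integrable variables\<close>

text \<open>
  The terms form a geometric series that starts at the first \<open>j\<close> with \<open>x \<le> 2 ^ j\<close>, and its first term is at most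
  \<open>x\<close>. This pointwise bound turns a first moment into a summable sequence of truncated second moments.
\<close>

lemma sum_dyadic_truncated_squares:
  fixes x :: real
  assumes "0 \<le> x"
  shows "(\<Sum>j<J. x\<^sup>2 * of_bool (x \<le> 2 ^ j) / 2 ^ j) \<le> 2 * x"
proof -
  \<comment> \<open>The subtracted term is the part of the geometric series from \<open>J\<close> on; it makes the induction close.\<close>
  have "if x \<le> 2 ^ J then (\<Sum>j<J. x\<^sup>2 * of_bool (x \<le> 2 ^ j) / 2 ^ j) \<le> 2 * x - 2 * x\<^sup>2 / 2 ^ J
    else (\<Sum>j<J. x\<^sup>2 * of_bool (x \<le> 2 ^ j) / 2 ^ j) = 0"
  proof (induction J)
    case 0
    then show ?case using assms by (simp add: power2_eq_square mult_left_le)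
  next
    case (Suc J)
    consider "x \<le> 2 ^ J" | "2 ^ J < x" "x \<le> 2 ^ Suc J" | "2 ^ Suc J < x"
      by linarith
    then show ?case
    proof cases
      case 1
      then have "x \<le> 2 ^ Suc J" using assms by simp
      moreover have "2 * x\<^sup>2 / 2 ^ Suc J = x\<^sup>2 / 2 ^ J" by simp
      ultimately show ?thesis using Suc 1 by simp
    next
      case 2
      have "x * x \<le> x * 2 ^ Suc J" using 2(2) assms by (rule mult_left_mono)
      then show ?thesis using Suc 2 by (simp add: field_simps power2_eq_square)
    next
      case 3
      then have "\<not> x \<le> 2 ^ J" using assms by simp
      then show ?thesis using Suc 3 by simp
    qed
  qed
  moreover have "0 \<le> 2 * x\<^sup>2 / 2 ^ J" by simp
  ultimately show ?thesis using assms by (simp split: if_splits; linarith)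
qed

text \<open>
  This is the companion bound for the probabilities that a variable exceeds the truncation level.
\<close>

lemma sum_dyadic_levels_below:
  fixes x :: real
  assumes "0 \<le> x"
  shows "(\<Sum>j<J. 2 ^ j * of_bool (2 ^ j < x)) \<le> 2 * x"
proof -
  have "(\<Sum>j<J. 2 ^ j * of_bool (2 ^ j < x)) \<le> min (2 ^ J) (2 * x)"
    using assms by (induction J) (auto simp: min_def split: if_splits)
  then show ?thesis by simp
qed

context prob_space
begin

lemma indep_vars_pair:
  assumes X: "indep_vars N X K" and ij: "i \<in> K" "j \<in> K" "i \<noteq> j"
  shows "indep_var (N i) (X i) (N j) (X j)"
proof -
  let ?G = "\<lambda>i. sigma_sets (space M) {X i -` S \<inter> space M | S. S \<in> sets (N i)}"
  have G: "indep_sets ?G K" and rv: "\<And>i. i \<in> K \<Longrightarrow> random_variable (N i) (X i)"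
    using X by (auto simp: indep_vars_def)
  have "prob (s \<inter> t) = prob s * prob t" if "s \<in> ?G i" "t \<in> ?G j" for s t
    using indep_setsD[OF G, of "{i, j}" "\<lambda>l. if l = i then s else t"] ij that by (auto simp: Int_commute)
  moreover have "?G i \<subseteq> events" "?G j \<subseteq> events"
    using G ij by (auto simp: indep_sets_def)
  ultimately have "indep_set (?G i) (?G j)"
    unfolding indep_sets2_eq by blast
  then show ?thesis
    unfolding indep_var_eq using rv ij by simp
qed

text \<open>
  Truncate at \<open>2 ^ j\<close> in the sum of the first \<open>2 ^ j\<close> terms. By the two dyadic bounds, both the variances of the
  truncated averages and the probabilities that some term is cut are summable over \<open>j\<close>, with total at most
  \<open>2 * expectation (B 1)\<close>. So along powers of two the averages are eventually below the mean plus any positive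
  number. The factor 2 is the price of passing from \<open>n\<close> to the next power of two; it is harmless because
  the bound is applied to variables whose mean is small.
\<close>

lemma pairwise_iid_sum_bound:
  fixes B :: "nat \<Rightarrow> 'a \<Rightarrow> real"
  assumes int: "\<And>m. 1 \<le> m \<Longrightarrow> integrable M (B m)"
    and nonneg: "\<And>m x. 0 \<le> B m x"
    and ident: "\<And>m. 1 \<le> m \<Longrightarrow> distr M borel (B m) = distr M borel (B 1)"
    and indep: "\<And>l m. 1 \<le> l \<Longrightarrow> l < m \<Longrightarrow> indep_var borel (B l) borel (B m)"
    and e: "0 < e"
  shows "AE x in M. \<forall>\<^sub>F n in sequentially. (\<Sum>m=1..n. B m x) \<le> (2 * expectation (B 1) + e) * real n"
proof -
  have meas[measurable]: "B m \<in> borel_measurable M" if "1 \<le> m" for m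
    using int[OF that] by simp
  have transfer: "expectation (\<lambda>x. h (B m x)) = expectation (\<lambda>x. h (B 1 x))"
    if "1 \<le> m" "h \<in> borel_measurable borel" for m and h :: "real \<Rightarrow> real"
    using integral_distr[OF meas[OF that(1)] that(2)] integral_distr[OF meas[OF order_refl] that(2)]
      ident[OF that(1)] by simp
  define \<mu> where "\<mu> = expectation (B 1)"
  define t :: "nat \<Rightarrow> real \<Rightarrow> real" where "t j y = y * of_bool (y \<le> 2 ^ j)" for j y
  have t_meas[measurable]: "t j \<in> borel_measurable borel" for j
    unfolding t_def[abs_def] by measurable
  have t_bound: "0 \<le> t j y" "t j y \<le> 2 ^ j" "t j y \<le> y" if "0 \<le> y" for j y
    using that by (auto simp: t_def)
  define c where "c j = expectation (\<lambda>x. t j (B 1 x))" for j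
  have t_int: "integrable M (\<lambda>x. t j (B m x))" if "1 \<le> m" for j m
    by (rule integrable_const_bound[of _ "2 ^ j"]) (use that t_bound[OF nonneg] in \<open>auto\<close>)
  have c_le: "c j \<le> \<mu>" for j
    unfolding c_def \<mu>_def by (intro Bochner_Integration.integral_mono t_int int t_bound nonneg) auto
  have c_nonneg: "0 \<le> c j" for j
    unfolding c_def by (intro Bochner_Integration.integral_nonneg t_bound nonneg)
  have c_eq: "expectation (\<lambda>x. t j (B m x)) = c j" if "1 \<le> m" for j m
    unfolding c_def by (rule transfer[OF that]) simp
  define D where "D j m x = t j (B m x) - c j" for j m x
  define v where "v j = expectation (\<lambda>x. (t j (B 1 x))\<^sup>2) / 2 ^ j" for j
  have t2_int: "integrable M (\<lambda>x. (t j (B m x))\<^sup>2)" if "1 \<le> m" for j m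
    by (rule integrable_const_bound[of _ "(2 ^ j)\<^sup>2"])
      (use that t_bound[OF nonneg] in \<open>auto intro!: power_mono\<close>)
  have DD: "integrable M (\<lambda>x. D j l x * D j m x)" if "1 \<le> l" "1 \<le> m" for j l m
  proof (rule integrable_const_bound[of _ "2 ^ j * 2 ^ j"])
    have D_bound: "\<bar>D j m x\<bar> \<le> 2 ^ j" for m x
    proof -
      have "c j \<le> 2 ^ j"
        unfolding c_def by (rule integral_le_const[OF t_int]) (use t_bound[OF nonneg] in auto)
      then show ?thesis
        using t_bound[OF nonneg, of j m x] c_nonneg[of j] by (simp add: D_def abs_le_iff)
    qed
    show "AE x in M. norm (D j l x * D j m x) \<le> 2 ^ j * 2 ^ j"
      using D_bound by (auto simp: abs_mult intro!: mult_mono)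
    show "(\<lambda>x. D j l x * D j m x) \<in> borel_measurable M"
      using that unfolding D_def by measurable
  qed
  have uncorr: "expectation (\<lambda>x. D j l x * D j m x) = 0" if "1 \<le> l" "l < m" for j l m
  proof -
    have "indep_var borel ((\<lambda>y. t j y - c j) \<circ> B l) borel ((\<lambda>y. t j y - c j) \<circ> B m)"
      by (rule indep_var_compose[OF indep[OF that]]) measurable
    then have "expectation (\<lambda>x. D j l x * D j m x) = expectation (D j l) * expectation (D j m)"
      using that t_int[of l j] t_int[of m j]
      by (intro indep_var_lebesgue_integral) (auto simp: D_def[abs_def] comp_def)
    also have "expectation (D j l) = 0"
      using that t_int[of l j] by (simp add: D_def[abs_def] c_eq prob_space)
    finally show ?thesis by simp
  qed
  have D2: "expectation (\<lambda>x. (D j m x)\<^sup>2) \<le> expectation (\<lambda>x. (t j (B 1 x))\<^sup>2)" if "1 \<le> m" for j m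
  proof -
    have "expectation (\<lambda>x. (D j m x)\<^sup>2) = expectation (\<lambda>x. (t j (B m x))\<^sup>2) - (c j)\<^sup>2"
      using variance_eq[OF t_int[OF that] t2_int[OF that], of j] that by (simp add: D_def c_eq)
    also have "\<dots> \<le> expectation (\<lambda>x. (t j (B m x))\<^sup>2)" by simp
    also have "\<dots> = expectation (\<lambda>x. (t j (B 1 x))\<^sup>2)"
      using that by (rule transfer) measurable
    finally show ?thesis .
  qed
  define Q where "Q j x = ((\<Sum>m=1..2 ^ j. D j m x) / 2 ^ j)\<^sup>2" for j x
  have Q_int: "integrable M (Q j)" for j
    unfolding Q_def power_divide
    by (intro integrable_divide expectation_square_uncorrelated_sum(1) DD uncorr) auto
  have Q_le: "expectation (Q j) \<le> v j" for j
  proof -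
    have "expectation (\<lambda>x. (\<Sum>m=1..2 ^ j. D j m x)\<^sup>2) = (\<Sum>m=1..2 ^ j. expectation (\<lambda>x. (D j m x)\<^sup>2))"
      by (rule expectation_square_uncorrelated_sum(2)) (auto intro: DD uncorr)
    also have "\<dots> \<le> (\<Sum>m=1..2 ^ j :: nat. expectation (\<lambda>x. (t j (B 1 x))\<^sup>2))"
      by (intro sum_mono D2) simp
    finally have "expectation (\<lambda>x. (\<Sum>m=1..2 ^ j. D j m x)\<^sup>2) \<le> 2 ^ j * expectation (\<lambda>x. (t j (B 1 x))\<^sup>2)"
      by simp
    then have "expectation (Q j) \<le> (2 ^ j * expectation (\<lambda>x. (t j (B 1 x))\<^sup>2)) / (2 ^ j)\<^sup>2"
      by (simp add: Q_def[abs_def] power_divide divide_right_mono)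
    then show ?thesis by (simp add: v_def power2_eq_square)
  qed
  have Q_nonneg: "0 \<le> expectation (Q j)" for j
    by (intro Bochner_Integration.integral_nonneg) (simp add: Q_def)
  have "(\<Sum>j<J. expectation (Q j)) \<le> 2 * \<mu>" for J
  proof -
    have "(\<Sum>j<J. expectation (Q j)) \<le> (\<Sum>j<J. v j)"
      by (intro sum_mono Q_le)
    also have "\<dots> = expectation (\<lambda>x. \<Sum>j<J. (t j (B 1 x))\<^sup>2 / 2 ^ j)"
      unfolding v_def using t2_int[of 1] by (subst Bochner_Integration.integral_sum) auto
    also have "\<dots> \<le> expectation (\<lambda>x. 2 * B 1 x)"
    proof (rule Bochner_Integration.integral_mono)
      show "integrable M (\<lambda>x. \<Sum>j<J. (t j (B 1 x))\<^sup>2 / 2 ^ j)"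
        using t2_int[of 1] by (intro Bochner_Integration.integrable_sum integrable_divide) auto
      show "integrable M (\<lambda>x. 2 * B 1 x)" using int[of 1] by simp
      show "(\<Sum>j<J. (t j (B 1 x))\<^sup>2 / 2 ^ j) \<le> 2 * B 1 x" for x
      proof -
        have "(t j (B 1 x))\<^sup>2 = (B 1 x)\<^sup>2 * of_bool (B 1 x \<le> 2 ^ j)" for j
          by (simp add: t_def)
        then show ?thesis
          using sum_dyadic_truncated_squares[OF nonneg[of 1 x], of J] by simp
      qed
    qed
    finally show ?thesis by (simp add: \<mu>_def)
  qed
  then have "summable (\<lambda>j. expectation (Q j))"
    using Q_nonneg by (intro summableI_nonneg_bounded)
  then have ae1: "AE x in M. (\<lambda>j. Q j x) \<longlonglongrightarrow> 0"
    by (rule AE_tendsto_0_summable_expectation[OF Q_int, rotated]) (simp add: Q_def)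
  \<comment> \<open>Off this event the truncation at \<open>2 ^ j\<close> changes none of the first \<open>2 ^ j\<close> terms.\<close>
  define E where "E j = (\<Union>m\<in>{1..2 ^ j}. {x \<in> space M. 2 ^ j < B m x})" for j :: nat
  have E_meas: "E j \<in> events" for j
    unfolding E_def by (intro sets.finite_UN) auto
  define w where "w j = prob {x \<in> space M. 2 ^ j < B 1 x}" for j :: nat
  have w_eq: "prob {x \<in> space M. 2 ^ j < B m x} = w j" if "1 \<le> m" for m j
  proof -
    have "prob {x \<in> space M. 2 ^ j < B m x} = measure (distr M borel (B m)) {2 ^ j<..}" if "1 \<le> m" for m
      using that by (subst measure_distr) (auto intro!: arg_cong[of _ _ prob])
    from this[OF that] this[of 1] show ?thesis
      unfolding w_def using ident[OF that] by simp
  qed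
  have E_le: "prob (E j) \<le> 2 ^ j * w j" for j
  proof -
    have "prob (E j) \<le> (\<Sum>m=1..2 ^ j. prob {x \<in> space M. 2 ^ j < B m x})"
      unfolding E_def by (intro finite_measure_subadditive_finite) auto
    also have "\<dots> = (\<Sum>m=1..2 ^ j :: nat. w j)"
      by (intro sum.cong refl w_eq) simp
    finally show ?thesis by simp
  qed
  have "(\<Sum>j<J. prob (E j)) \<le> 2 * \<mu>" for J
  proof -
    have ind: "2 ^ j * w j = expectation (\<lambda>x. 2 ^ j * of_bool (2 ^ j < B 1 x))" for j
    proof -
      have "w j = expectation (indicator {x \<in> space M. 2 ^ j < B 1 x})"
        by (simp add: w_def)
      also have "\<dots> = expectation (\<lambda>x. of_bool (2 ^ j < B 1 x))"
        by (intro Bochner_Integration.integral_cong) (auto simp: indicator_def)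
      finally show ?thesis by simp
    qed
    have ind_int: "integrable M (\<lambda>x. 2 ^ j * of_bool (2 ^ j < B 1 x) :: real)" for j
      by (rule integrable_const_bound[of _ "2 ^ j"]) auto
    have "(\<Sum>j<J. prob (E j)) \<le> (\<Sum>j<J. 2 ^ j * w j)"
      by (intro sum_mono E_le)
    also have "\<dots> = expectation (\<lambda>x. \<Sum>j<J. 2 ^ j * of_bool (2 ^ j < B 1 x))"
      unfolding ind using ind_int by (subst Bochner_Integration.integral_sum) auto
    also have "\<dots> \<le> expectation (\<lambda>x. 2 * B 1 x)"
      by (intro Bochner_Integration.integral_mono Bochner_Integration.integrable_sum ind_int
          sum_dyadic_levels_below nonneg) (use int[of 1] in auto)
    finally show ?thesis by (simp add: \<mu>_def)
  qed
  then have "summable (\<lambda>j. prob (E j))"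
    by (intro summableI_nonneg_bounded) auto
  then have ae2: "AE x in M. \<forall>\<^sub>F j in sequentially. x \<in> space M - E j"
    by (intro borel_cantelli_AE1 E_meas) (simp_all add: emeasure_eq_measure)
  from ae1 ae2 show ?thesis
  proof eventually_elim
    case (elim x)
    have "(\<lambda>j. sqrt (Q j x)) \<longlonglongrightarrow> sqrt 0"
      using elim(1) by (rule tendsto_real_sqrt)
    then have "(\<lambda>j. \<bar>(\<Sum>m=1..2 ^ j. D j m x) / 2 ^ j\<bar>) \<longlonglongrightarrow> 0"
      unfolding Q_def by (simp only: real_sqrt_abs real_sqrt_zero)
    then have "\<forall>\<^sub>F j in sequentially. \<bar>(\<Sum>m=1..2 ^ j. D j m x) / 2 ^ j\<bar> < e / 2"
      by (rule order_tendstoD(2)) (use e in simp)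
    then have "\<forall>\<^sub>F j in sequentially. (\<Sum>m=1..2 ^ j. B m x) \<le> (\<mu> + e / 2) * 2 ^ j"
      using elim(2)
    proof eventually_elim
      case (elim j)
      have "(\<Sum>m=1..2 ^ j. D j m x) / 2 ^ j \<le> e / 2" using elim(1) by linarith
      then have *: "(\<Sum>m=1..2 ^ j. D j m x) \<le> e / 2 * 2 ^ j"
        by (simp add: pos_divide_le_eq)
      have "(\<Sum>m=1..2 ^ j. B m x) = (\<Sum>m=1..2 ^ j. D j m x + c j)"
        using elim(2) by (intro sum.cong refl) (auto simp: E_def D_def t_def not_less)
      also have "\<dots> = (\<Sum>m=1..2 ^ j. D j m x) + c j * 2 ^ j"
        by (simp add: sum.distrib)
      also have "\<dots> \<le> e / 2 * 2 ^ j + \<mu> * 2 ^ j"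
        by (intro add_mono * mult_right_mono c_le) simp
      finally show ?case by (simp add: algebra_simps)
    qed
    then obtain j0 where j0: "\<And>j. j0 \<le> j \<Longrightarrow> (\<Sum>m=1..2 ^ j. B m x) \<le> (\<mu> + e / 2) * 2 ^ j"
      by (auto simp: eventually_sequentially)
    show ?case
      using eventually_ge_at_top[of "2 ^ j0 :: nat"]
    proof (rule eventually_mono)
      fix n :: nat assume n: "2 ^ j0 \<le> n"
      then have n0: "0 < n" by (metis less_le_trans zero_less_numeral zero_less_power)
      \<comment> \<open>The sums are monotone, so \<open>n\<close> may be replaced by the next power of two, which is at most \<open>2 * n\<close>.\<close>
      define j where "j = Suc (floor_log n)"
      have "j0 \<le> floor_log n" using floor_log_le_iff[OF n] by simp
      then have j: "j0 \<le> j" "n \<le> 2 ^ j" "2 ^ j \<le> 2 * n"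
        using floor_log_exp2_gt[of n] floor_log_exp2_le[OF n0] by (auto simp: j_def)
      have "(\<Sum>m=1..n. B m x) \<le> (\<Sum>m=1..2 ^ j. B m x)"
        using j(2) nonneg by (intro sum_mono2) auto
      also have "\<dots> \<le> (\<mu> + e / 2) * 2 ^ j" by (rule j0[OF j(1)])
      also have "\<dots> \<le> (\<mu> + e / 2) * real (2 * n)"
      proof (rule mult_left_mono)
        show "2 ^ j \<le> real (2 * n)" using j(3) by (metis of_nat_le_iff of_nat_numeral of_nat_power)
        show "0 \<le> \<mu> + e / 2" using c_le[of 0] c_nonneg[of 0] e by simp
      qed
      finally show "(\<Sum>m=1..n. B m x) \<le> (2 * expectation (B 1) + e) * real n"
        by (simp add: \<mu>_def algebra_simps)
    qed
  qed
qed

end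

section \<open>Information available before and at a recall\<close>

lemma coord_vec_eq_iff [simp]: "coord_vec k = coord_vec l \<longleftrightarrow> k = l"
proof -
  have "axis i (1::real) \<noteq> 0" "0 \<noteq> axis i (1::real)" for i :: 'a
    by (auto simp: axis_eq_0_iff)
  then show ?thesis
    by (cases k; cases l) (auto simp: coord_vec_def axis_eq_axis)
qed

lemma coord_vec_nth: "coord_vec k $ c = of_bool (k = Some c)"
  by (cases k) (auto simp: coord_vec_def axis_def)

definition next_colour :: "'d option \<Rightarrow> 'd option \<Rightarrow> bool \<Rightarrow> 'd option" where
  "next_colour l i j = (case l of None \<Rightarrow> i | Some c \<Rightarrow> if j then Some c else None)"

lemma preimages_subset:
  assumes "f \<in> measurable F N" "space F = space M"
  shows "preimages M f N \<subseteq> sets F"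
  using measurable_sets[OF assms(1)] assms(2) by (auto simp: preimages_def)

lemma measurable_from_preimages:
  assumes "preimages M f N \<subseteq> sets F" "space F = space M" "f \<in> space M \<rightarrow> space N"
  shows "f \<in> measurable F N"
  using assms by (auto simp: preimages_def measurable_def)

lemma measurable_larger:
  assumes "f \<in> measurable F N" "sets F \<subseteq> sets G" "space F = space G"
  shows "f \<in> measurable G N"
  using assms by (auto simp: measurable_def)

context delayed_erw
begin

definition noise_algebra :: "nat \<Rightarrow> 'w measure" where
  "noise_algebra n = sigma (space M) (noise n)"

text \<open>
  What is known at time \<open>n\<close> when the recalled epoch has been chosen but \<open>A n\<close>, \<open>I n\<close> and \<open>J n\<close> have not been used.
\<close>

definition recall_algebra :: "nat \<Rightarrow> 'w measure" where
  "recall_algebra n = sigma (space M)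
     (sets (history (n - 1)) \<union> preimages M (\<tau> n) (count_space UNIV))"

lemma noise_sequences_measurable:
  assumes "1 \<le> m"
  shows "A m \<in> borel_measurable M" "I m \<in> measurable M (count_space UNIV)"
    "J m \<in> measurable M (count_space UNIV)"
  using A_indep I_indep J_indep assms by (auto simp: indep_vars_def)

lemma noise_Pow: "noise m \<subseteq> Pow (space M)"
  by (auto simp: noise_def preimages_def)

lemma space_algebras [simp]:
  "space (history n) = space M" "space (noise_algebra n) = space M" "space (recall_algebra n) = space M"
  by (simp_all add: history_def noise_algebra_def recall_algebra_def space_measure_of_conv)

lemma sets_history:
  "sets (history n) = sigma_sets (space M) (preimages M U borel \<union> (\<Union>m\<in>{1..n}. noise m)
     \<union> (\<Union>m\<in>{2..n}. preimages M (\<tau> m) (count_space UNIV)))"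
  unfolding history_def
  by (rule sets_measure_of) (use noise_Pow in \<open>auto simp: preimages_def\<close>)

lemma sets_noise_algebra: "sets (noise_algebra n) = sigma_sets (space M) (noise n)"
  unfolding noise_algebra_def by (rule sets_measure_of[OF noise_Pow])

lemma sets_recall_algebra:
  "sets (recall_algebra n) = sigma_sets (space M)
     (sets (history (n - 1)) \<union> preimages M (\<tau> n) (count_space UNIV))"
  unfolding recall_algebra_def
  by (rule sets_measure_of) (use sets.sets_into_space[of _ "history (n - 1)"] in \<open>auto simp: preimages_def\<close>)

lemma sigma_sets_le:
  assumes "G \<subseteq> sets F" "space F = space M"
  shows "sigma_sets (space M) G \<subseteq> sets F"
  using sets.sigma_sets_subset[OF assms(1)] assms(2) by simp

lemma noise_events: "1 \<le> m \<Longrightarrow> noise m \<subseteq> events"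
  unfolding noise_def using noise_sequences_measurable[of m] by (auto dest: preimages_subset[OF _ refl])

lemma noise_algebra_le: "1 \<le> m \<Longrightarrow> sets (noise_algebra m) \<subseteq> events"
  unfolding sets_noise_algebra by (intro sigma_sets_le noise_events) auto

lemma history_le: "sets (history n) \<subseteq> events"
proof -
  have "preimages M U borel \<subseteq> events" by (rule preimages_subset[OF U_measurable refl])
  moreover have "preimages M (\<tau> m) (count_space UNIV) \<subseteq> events" if "m \<in> {2..n}" for m
    using that by (intro preimages_subset[OF \<tau>_measurable refl]) auto
  ultimately show ?thesis
    unfolding sets_history using noise_events by (intro sigma_sets_le Un_least UN_least) auto
qed

lemma recall_algebra_le: "1 < n \<Longrightarrow> sets (recall_algebra n) \<subseteq> events"
  unfolding sets_recall_algebra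
  using history_le preimages_subset[OF \<tau>_measurable refl] by (intro sigma_sets_le) auto

lemma history_mono: "m \<le> n \<Longrightarrow> sets (history m) \<subseteq> sets (history n)"
  unfolding sets_history by (intro sigma_sets_mono') auto

lemma noise_le_history:
  assumes "1 \<le> n" shows "sets (noise_algebra n) \<subseteq> sets (history n)"
  unfolding sets_noise_algebra sets_history using assms by (intro sigma_sets_mono') auto

lemma history_le_recall: "sets (history (n - 1)) \<subseteq> sets (recall_algebra n)"
  unfolding sets_recall_algebra by auto

lemma recall_le_history:
  assumes "1 < n" shows "sets (recall_algebra n) \<subseteq> sets (history n)"
proof -
  have "preimages M (\<tau> n) (count_space UNIV) \<subseteq> sets (history n)"
    unfolding sets_history using assms by auto
  then show ?thesis
    unfolding sets_recall_algebra using history_mono[of "n - 1" n] by (intro sigma_sets_le) auto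
qed

lemma history_measurable_mono: "f \<in> measurable (history m) N \<Longrightarrow> m \<le> n \<Longrightarrow> f \<in> measurable (history n) N"
  by (erule measurable_larger) (simp_all add: history_mono)

lemma noise_measurable:
  "A m \<in> borel_measurable (noise_algebra m)"
  "I m \<in> measurable (noise_algebra m) (count_space UNIV)"
  "J m \<in> measurable (noise_algebra m) (count_space UNIV)"
  by (rule measurable_from_preimages; auto simp: sets_noise_algebra noise_def)+

lemma U_history: "U \<in> borel_measurable (history n)"
  by (rule measurable_from_preimages) (auto simp: sets_history)

lemma \<tau>_recall: "\<tau> n \<in> measurable (recall_algebra n) (count_space UNIV)"
  by (rule measurable_from_preimages) (auto simp: sets_recall_algebra)

text \<open>
  The generators of the two algebras lie in the two families that the model declares independent.
\<close>

lemma noise_indep_recall: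
  assumes n: "1 < n" and \<eta>: "\<eta> \<in> borel_measurable (noise_algebra n)"
    and \<zeta>: "\<zeta> \<in> borel_measurable (recall_algebra n)"
  shows "indep_var borel \<eta> borel \<zeta>"
proof -
  have "sigma_sets (space M) (preimages M \<eta> borel) \<subseteq> sigma_sets (space M) (\<Union>m\<in>{n..}. noise m)"
  proof -
    have "preimages M \<eta> borel \<subseteq> sigma_sets (space M) (noise n)"
      using preimages_subset[OF \<eta>] by (simp add: sets_noise_algebra)
    also have "\<dots> \<subseteq> sigma_sets (space M) (\<Union>m\<in>{n..}. noise m)"
      by (intro sigma_sets_mono') auto
    finally show ?thesis by (intro sigma_sets_mono)
  qed
  moreover have "sigma_sets (space M) (preimages M \<zeta> borel) \<subseteq> sigma_sets (space M)
      (sets (history (n - 1)) \<union> preimages M (\<tau> n) (count_space UNIV))"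
    using preimages_subset[OF \<zeta>] by (intro sigma_sets_mono) (simp add: sets_recall_algebra)
  ultimately have "indep_set (sigma_sets (space M) (preimages M \<eta> borel))
      (sigma_sets (space M) (preimages M \<zeta> borel))"
    using future_indep[OF n] unfolding indep_sets2_eq by blast
  moreover have "\<eta> \<in> borel_measurable M" "\<zeta> \<in> borel_measurable M"
    using n measurable_larger[OF \<eta> noise_algebra_le] measurable_larger[OF \<zeta> recall_algebra_le[OF n]]
    by auto
  ultimately show ?thesis
    by (simp add: indep_var_eq preimages_def)
qed

text \<open>
  The weight \<open>\<xi> m\<close> is known before the noise of time \<open>m\<close> is revealed, as are all earlier terms. So the centred noise
  is independent of what multiplies it in a product of two terms, and the terms are uncorrelated. The weights will
  be indicators of the recalled colour.
\<close>

lemma weighted_noise_SLLN: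
  fixes \<xi> \<eta> :: "nat \<Rightarrow> 'w \<Rightarrow> real"
  assumes \<xi>: "\<And>m. 1 < m \<Longrightarrow> \<xi> m \<in> borel_measurable (recall_algebra m)"
    and \<xi>_bound: "\<And>m \<omega>. \<bar>\<xi> m \<omega>\<bar> \<le> 1"
    and \<eta>: "\<And>m. 1 < m \<Longrightarrow> \<eta> m \<in> borel_measurable (noise_algebra m)"
    and \<eta>_bound: "\<And>m \<omega>. \<bar>\<eta> m \<omega>\<bar> \<le> C"
    and mean: "\<And>m. 1 < m \<Longrightarrow> expectation (\<eta> m) = \<mu>"
  shows "AE \<omega> in M. (\<lambda>n. (\<Sum>m=2..n. \<xi> m \<omega> * (\<eta> m \<omega> - \<mu>)) / real n) \<longlonglongrightarrow> 0"
proof -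
  define D where "D m \<omega> = \<xi> m \<omega> * (\<eta> m \<omega> - \<mu>)" for m \<omega>
  have \<eta>M: "\<eta> m \<in> borel_measurable M" if "1 < m" for m
    using measurable_larger[OF \<eta>[OF that] noise_algebra_le] that by simp
  have D_history: "D m \<in> borel_measurable (history m)" if "1 < m" for m
  proof -
    have [measurable]: "\<xi> m \<in> borel_measurable (history m)" "\<eta> m \<in> borel_measurable (history m)"
      using that measurable_larger[OF \<xi>[OF that] recall_le_history]
        measurable_larger[OF \<eta>[OF that] noise_le_history] by auto
    show ?thesis unfolding D_def by measurable
  qed
  have DM: "D m \<in> borel_measurable M" if "1 < m" for m
    using measurable_larger[OF D_history[OF that] history_le] by simp
  have D_bound: "\<bar>D m \<omega>\<bar> \<le> C + \<bar>\<mu>\<bar>" for m \<omega>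
  proof -
    have "\<bar>D m \<omega>\<bar> \<le> 1 * (C + \<bar>\<mu>\<bar>)"
      unfolding D_def abs_mult using \<xi>_bound[of m \<omega>] \<eta>_bound[of m \<omega>]
      by (intro mult_mono) auto
    then show ?thesis by simp
  qed
  have uncorr: "expectation (\<lambda>\<omega>. D l \<omega> * D m \<omega>) = 0" if "2 \<le> l" "l < m" for l m
  proof -
    have m: "1 < m" using that by simp
    define \<zeta> where "\<zeta> \<omega> = D l \<omega> * \<xi> m \<omega>" for \<omega>
    have "sets (history l) \<subseteq> sets (recall_algebra m)"
      using that by (intro order_trans[OF history_mono history_le_recall]) simp
    then have [measurable]: "D l \<in> borel_measurable (recall_algebra m)"
      using measurable_larger[OF D_history[of l]] that by simp
    have [measurable]: "\<xi> m \<in> borel_measurable (recall_algebra m)" by (rule \<xi>[OF m])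
    have \<zeta>: "\<zeta> \<in> borel_measurable (recall_algebra m)"
      unfolding \<zeta>_def[abs_def] by measurable
    have [measurable]: "\<eta> m \<in> borel_measurable (noise_algebra m)" by (rule \<eta>[OF m])
    have "indep_var borel (\<lambda>\<omega>. \<eta> m \<omega> - \<mu>) borel \<zeta>"
      by (rule noise_indep_recall[OF m _ \<zeta>]) measurable
    moreover have int: "integrable M (\<eta> m)"
      using \<eta>_bound by (intro integrable_const_bound[OF _ \<eta>M[OF m]]) auto
    moreover have "integrable M \<zeta>"
    proof (rule integrable_const_bound)
      have "norm (\<zeta> \<omega>) \<le> (C + \<bar>\<mu>\<bar>) * 1" for \<omega>
        unfolding \<zeta>_def real_norm_def abs_mult
        using order_trans[OF abs_ge_zero D_bound] by (intro mult_mono D_bound \<xi>_bound) auto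
      then show "AE \<omega> in M. norm (\<zeta> \<omega>) \<le> (C + \<bar>\<mu>\<bar>) * 1" by (rule AE_I2)
      show "\<zeta> \<in> borel_measurable M"
        using measurable_larger[OF \<zeta> recall_algebra_le[OF m]] by simp
    qed
    ultimately have "expectation (\<lambda>\<omega>. (\<eta> m \<omega> - \<mu>) * \<zeta> \<omega>)
        = expectation (\<lambda>\<omega>. \<eta> m \<omega> - \<mu>) * expectation \<zeta>"
      by (intro indep_var_lebesgue_integral) auto
    also have "expectation (\<lambda>\<omega>. \<eta> m \<omega> - \<mu>) = 0"
      using int mean[OF m] by (simp add: prob_space)
    finally show ?thesis
      by (simp add: \<zeta>_def D_def mult_ac)
  qed
  show ?thesis
    using bounded_uncorrelated_SLLN[of 2 D "C + \<bar>\<mu>\<bar>"] DM D_bound uncorr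
    by (simp add: D_def)
qed

end

section \<open>Colours of epochs and the memory mass of a colour\<close>

context delayed_erw
begin

text \<open>
  Working with the index of a step instead of the vector makes the dynamics a function of a finite type.
  The value is meaningful for \<open>n \<ge> 1\<close>, where \<open>X n\<close> is a coordinate vector or zero.
\<close>

definition colour :: "nat \<Rightarrow> 'w \<Rightarrow> 'd option" where
  "colour n \<omega> = inv coord_vec (X n \<omega>)"

definition recalled :: "nat \<Rightarrow> 'w \<Rightarrow> 'd option" where
  "recalled n \<omega> = colour (\<tau> n \<omega>) \<omega>"

lemma X_eq: "1 \<le> n \<Longrightarrow> \<omega> \<in> space M \<Longrightarrow> X n \<omega> = coord_vec (colour n \<omega>)"
  using X_range[of n \<omega>] by (simp add: colour_def f_inv_into_f)

lemma X_recalled: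
  assumes "1 < n" "\<omega> \<in> space M"
  shows "X (\<tau> n \<omega>) \<omega> = coord_vec (recalled n \<omega>)"
  using \<tau>_range[OF assms] assms(2) by (simp add: recalled_def X_eq)

lemma colour_next:
  assumes "1 < n" "\<omega> \<in> space M"
  shows "colour n \<omega> = next_colour (recalled n \<omega>) (I n \<omega>) (J n \<omega>)"
proof -
  have "X n \<omega> = coord_vec (next_colour (recalled n \<omega>) (I n \<omega>) (J n \<omega>))"
    using X_from_rest[OF assms] X_from_move[OF assms] X_recalled[OF assms]
    by (cases "recalled n \<omega>") (simp_all add: next_colour_def)
  then show ?thesis using X_eq[of n \<omega>] assms by simp
qed

text \<open>
  The function is one of finitely many measurable ones on each of the measurable events \<open>\<tau> n = u\<close>.
\<close>

lemma measurable_at_recalled_epoch: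
  assumes n: "1 < n"
    and f: "\<And>u. 1 \<le> u \<Longrightarrow> u < n \<Longrightarrow> f u \<in> measurable (recall_algebra n) N"
  shows "(\<lambda>\<omega>. f (\<tau> n \<omega>) \<omega>) \<in> measurable (recall_algebra n) N"
proof (rule measurable_compose_countable'[where I = "{1..n - 1}" and g = "\<tau> n"])
  show "\<tau> n \<in> measurable (recall_algebra n) (count_space {1..n - 1})"
    using measurable_sets[OF \<tau>_recall[of n]] \<tau>_range[OF n]
    by (auto simp: measurable_def)
qed (use n f in auto)

text \<open>
  Both parts are proved in one induction: the recalled colour at time \<open>n\<close> is the colour of an earlier epoch,
  and the colour of epoch \<open>n\<close> is a function of the recalled colour and the noise of time \<open>n\<close>.
\<close>

lemma colour_and_recalled_measurable:
  "(1 \<le> n \<longrightarrow> colour n \<in> measurable (history n) (count_space UNIV)) \<and>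
   (1 < n \<longrightarrow> recalled n \<in> measurable (recall_algebra n) (count_space UNIV))"
proof (induction n rule: less_induct)
  case (less n)
  have rec: "recalled n \<in> measurable (recall_algebra n) (count_space UNIV)" if n: "1 < n"
    unfolding recalled_def[abs_def]
  proof (rule measurable_at_recalled_epoch[OF n])
    fix u assume u: "1 \<le> u" "u < n"
    then have "colour u \<in> measurable (history (n - 1)) (count_space UNIV)"
      using less[of u] by (auto intro: history_measurable_mono)
    then show "colour u \<in> measurable (recall_algebra n) (count_space UNIV)"
      by (rule measurable_larger[OF _ history_le_recall]) simp
  qed
  moreover have "colour n \<in> measurable (history n) (count_space UNIV)" if n1: "1 \<le> n"
  proof (cases "n = 1")
    case True
    have "colour 1 -` {k} \<inter> space M = U -` {coord_vec k} \<inter> space M" for k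
      using X_1 X_eq[of 1] by (auto simp: vimage_def)
    moreover have "U -` {coord_vec k} \<inter> space M \<in> sets (history n)" for k
      using measurable_sets[OF U_history[of n], of "{coord_vec k}"] by simp
    ultimately show ?thesis
      using True by (subst measurable_count_space_eq2) auto
  next
    case False
    then have n: "1 < n" using n1 by simp
    have R: "recalled n \<in> measurable (history n) (count_space UNIV)"
      by (rule measurable_larger[OF rec[OF n] recall_le_history[OF n]]) simp
    have IJ: "I n \<in> measurable (history n) (count_space UNIV)" "J n \<in> measurable (history n) (count_space UNIV)"
      using n by (auto intro!: measurable_larger[OF noise_measurable(2) noise_le_history]
          measurable_larger[OF noise_measurable(3) noise_le_history])
    have "(\<lambda>\<omega>. next_colour (recalled n \<omega>) (I n \<omega>) (J n \<omega>)) \<in> measurable (history n) (count_space UNIV)"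
      by (rule measurable_compose_countable[OF _ R], rule measurable_compose_countable[OF _ IJ(1)],
          rule measurable_compose[OF IJ(2)]) simp
    then show ?thesis
      by (rule measurable_cong[THEN iffD1, rotated]) (simp add: colour_next[OF n])
  qed
  ultimately show ?case by blast
qed

lemma colour_measurable: "1 \<le> n \<Longrightarrow> colour n \<in> measurable (history n) (count_space UNIV)"
  using colour_and_recalled_measurable by blast

lemma recalled_measurable: "1 < n \<Longrightarrow> recalled n \<in> measurable (recall_algebra n) (count_space UNIV)"
  using colour_and_recalled_measurable by blast

lemma Mem_old:
  assumes n: "1 < n" and \<omega>: "\<omega> \<in> space M" and u: "u \<in> {1..n - 1}"
  shows "Mem n u \<omega> = Mem (n - 1) u \<omega> + of_bool (\<tau> n \<omega> = u) * A n \<omega> $ colour u \<omega>"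
  using Mem_other[OF n \<omega> u] Mem_recalled[OF n \<omega> X_recalled[OF n \<omega>]]
  by (auto simp: recalled_def)

lemma Mem_measurable: "1 \<le> u \<Longrightarrow> u \<le> n \<Longrightarrow> Mem n u \<in> borel_measurable (history n)"
proof (induction n)
  case (Suc n)
  show ?case
  proof (cases "u = Suc n")
    case True
    have "Mem (Suc n) u \<omega> = 1" if "\<omega> \<in> space M" for \<omega>
      using True that Mem_1 Mem_new[of "Suc n"] by (cases "n = 0") auto
    then show ?thesis
      by (subst measurable_cong[where g = "\<lambda>_. 1"]) auto
  next
    case False
    then have u: "u \<in> {1..Suc n - 1}" and n: "1 < Suc n" using Suc.prems by auto
    have [measurable]: "Mem n u \<in> borel_measurable (history (Suc n))"
      using Suc.IH u by (auto intro: history_measurable_mono)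
    have [measurable]: "colour u \<in> measurable (history (Suc n)) (count_space UNIV)"
      using colour_measurable[of u] u by (auto intro: history_measurable_mono)
    have [measurable]: "\<tau> (Suc n) \<in> measurable (history (Suc n)) (count_space UNIV)"
      by (rule measurable_larger[OF \<tau>_recall recall_le_history[OF n]]) simp
    have A[measurable]: "A (Suc n) \<in> borel_measurable (history (Suc n))"
      by (rule measurable_larger[OF noise_measurable(1) noise_le_history]) simp_all
    have [measurable]: "(\<lambda>\<omega>. A (Suc n) \<omega> $ i) \<in> borel_measurable (history (Suc n))" for i
      by (rule measurable_compose[OF A]) (intro borel_measurable_continuous_onI continuous_intros)
    have "(\<lambda>\<omega>. Mem n u \<omega> + of_bool (\<tau> (Suc n) \<omega> = u) * A (Suc n) \<omega> $ colour u \<omega>)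
        \<in> borel_measurable (history (Suc n))"
      by measurable
    then show ?thesis
      by (rule measurable_cong[THEN iffD1, rotated]) (use Mem_old[OF n _ u] in simp)
  qed
qed simp

definition mass :: "nat \<Rightarrow> 'd option \<Rightarrow> 'w \<Rightarrow> real" where
  "mass n k \<omega> = (\<Sum>u=1..n. of_bool (colour u \<omega> = k) * Mem n u \<omega>)"

definition total_mass :: "nat \<Rightarrow> 'w \<Rightarrow> real" where
  "total_mass n \<omega> = (\<Sum>u=1..n. Mem n u \<omega>)"

lemma total_mass_eq: "total_mass n \<omega> = (\<Sum>k\<in>UNIV. mass n k \<omega>)"
  unfolding total_mass_def mass_def
  by (subst sum.swap) (simp add: sum_distrib_right[symmetric] of_bool_def)

text \<open>
  An epoch of colour \<open>k\<close> brings one unit of mass when it is created, and each recall of colour \<open>k\<close>, whichever epoch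
  is hit, adds the coordinate \<open>k\<close> of \<open>A\<close>. This makes the individual memories disappear from the problem.
\<close>

lemma mass_eq:
  assumes \<omega>: "\<omega> \<in> space M" and "1 \<le> n"
  shows "mass n k \<omega> = (\<Sum>m=1..n. of_bool (colour m \<omega> = k)) + (\<Sum>m=2..n. of_bool (recalled m \<omega> = k) * A m \<omega> $ k)"
  using assms(2)
proof (induction n rule: dec_induct)
  case base
  then show ?case using Mem_1[OF \<omega>] by (simp add: mass_def)
next
  case (step n)
  have n: "1 < Suc n" using step by simp
  have \<tau>: "\<tau> (Suc n) \<omega> \<in> {1..n}" using \<tau>_range[OF n \<omega>] by simp
  have "mass (Suc n) k \<omega> = (\<Sum>u=1..n. of_bool (colour u \<omega> = k) * Mem (Suc n) u \<omega>) + of_bool (colour (Suc n) \<omega> = k)"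
    using Mem_new[OF n \<omega>] by (simp add: mass_def)
  also have "(\<Sum>u=1..n. of_bool (colour u \<omega> = k) * Mem (Suc n) u \<omega>)
      = (\<Sum>u=1..n. of_bool (colour u \<omega> = k) * Mem n u \<omega> +
          (if \<tau> (Suc n) \<omega> = u then of_bool (colour u \<omega> = k) * A (Suc n) \<omega> $ k else 0))"
    using Mem_old[OF n \<omega>] by (intro sum.cong) (auto simp: distrib_left)
  also have "\<dots> = mass n k \<omega> + of_bool (recalled (Suc n) \<omega> = k) * A (Suc n) \<omega> $ k"
    using \<tau> by (simp add: sum.distrib mass_def recalled_def)
  finally show ?case
    using step by simp
qed

lemma mass_measurable: "mass n k \<in> borel_measurable (history n)"
proof -
  have "(\<lambda>\<omega>. of_bool (colour u \<omega> = k) * Mem n u \<omega>) \<in> borel_measurable (history n)" if "u \<in> {1..n}" for u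
  proof -
    have [measurable]: "colour u \<in> measurable (history n) (count_space UNIV)"
      using colour_measurable[of u] that by (auto intro: history_measurable_mono)
    have [measurable]: "Mem n u \<in> borel_measurable (history n)"
      using that by (intro Mem_measurable) auto
    show ?thesis by measurable
  qed
  then show ?thesis unfolding mass_def[abs_def] by (rule borel_measurable_sum)
qed

lemma total_mass_measurable: "total_mass n \<in> borel_measurable (history n)"
  unfolding total_mass_eq[abs_def] using mass_measurable by (intro borel_measurable_sum)

lemma AE_A_nonneg: "AE \<omega> in M. \<forall>m\<ge>1. \<forall>i. 0 \<le> A m \<omega> $ i"
  using A_nonneg by (auto simp: AE_all_countable)

lemma AE_Mem_pos: "AE \<omega> in M. \<forall>n u. 1 \<le> u \<longrightarrow> u \<le> n \<longrightarrow> 1 \<le> Mem n u \<omega>"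
  using AE_A_nonneg AE_space
proof eventually_elim
  case (elim \<omega>)
  have "1 \<le> Mem n u \<omega>" if "1 \<le> u" "u \<le> n" for n u
    using that(2,1)
  proof (induction n rule: dec_induct)
    case base
    then show ?case using Mem_1[of \<omega>] Mem_new[of u \<omega>] elim(2) by (cases "u = 1") auto
  next
    case (step n)
    then show ?case
      using Mem_old[of "Suc n" \<omega> u] elim by (simp add: add_increasing2)
  qed
  then show ?case by blast
qed

definition share :: "nat \<Rightarrow> 'd option \<Rightarrow> 'w \<Rightarrow> real" where
  "share n k \<omega> = mass n k \<omega> / total_mass n \<omega>"

lemma share_measurable: "share n k \<in> borel_measurable (history n)"
  unfolding share_def[abs_def] using mass_measurable total_mass_measurable by (intro borel_measurable_divide)

lemma AE_share_bounds: "AE \<omega> in M. \<forall>n k. 0 \<le> share n k \<omega> \<and> share n k \<omega> \<le> 1"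
  using AE_Mem_pos
proof eventually_elim
  case (elim \<omega>)
  have nonneg: "0 \<le> Mem n u \<omega>" if "u \<in> {1..n}" for n u
    using elim that by (meson atLeastAtMost_iff order_trans zero_le_one)
  have "0 \<le> mass n k \<omega>" "mass n k \<omega> \<le> total_mass n \<omega>" for n k
    using nonneg unfolding mass_def total_mass_def
    by (auto intro!: sum_nonneg sum_mono simp: of_bool_def)
  then show ?case
    unfolding share_def by (metis divide_le_eq_1 divide_nonneg_nonneg order_trans le_less div_by_0 zero_le_one)
qed

end

section \<open>Laws of large numbers along the walk\<close>

context delayed_erw
begin

lemma sigma_finite_history: "sigma_finite_subalgebra M (history n)"
  by (intro finite_measure_subalgebra_is_sigma_finite)
    (unfold_locales, auto simp: subalgebra_def history_le[THEN subsetD])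

text \<open>
  The share is the conditional probability, given the history, of recalling colour \<open>k\<close>: this sums the conditional
  probabilities of the individual epochs over the epochs of that colour.
\<close>

lemma expectation_recalled_eq_share:
  assumes n: "1 < n" and Z[measurable]: "Z \<in> borel_measurable (history (n - 1))"
    and Z_bound: "AE \<omega> in M. \<bar>Z \<omega>\<bar> \<le> C"
  shows "integrable M (\<lambda>\<omega>. Z \<omega> * of_bool (recalled n \<omega> = k))"
    and "integrable M (\<lambda>\<omega>. Z \<omega> * share (n - 1) k \<omega>)"
    and "expectation (\<lambda>\<omega>. Z \<omega> * of_bool (recalled n \<omega> = k)) = expectation (\<lambda>\<omega>. Z \<omega> * share (n - 1) k \<omega>)"
proof -
  interpret sigma_finite_subalgebra M "history (n - 1)" by (rule sigma_finite_history)
  define T where "T u = {\<omega> \<in> space M. \<tau> n \<omega> = u}" for u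
  define Y where "Y u \<omega> = Z \<omega> * of_bool (colour u \<omega> = k)" for u \<omega>
  have T[measurable]: "T u \<in> events" for u
    using measurable_sets[OF \<tau>_measurable[OF n], of "{u}"] by (simp add: T_def vimage_def Int_def conj_commute)
  have Y: "Y u \<in> borel_measurable (history (n - 1))" if "u \<in> {1..n - 1}" for u
  proof -
    have [measurable]: "colour u \<in> measurable (history (n - 1)) (count_space UNIV)"
      using colour_measurable[of u] that by (auto intro: history_measurable_mono)
    show ?thesis unfolding Y_def by measurable
  qed
  have YT: "integrable M (\<lambda>\<omega>. Y u \<omega> * indicator (T u) \<omega>)" if "u \<in> {1..n - 1}" for u
  proof (rule integrable_const_bound)
    have [measurable]: "Y u \<in> borel_measurable M"
      using measurable_larger[OF Y[OF that] history_le] by simp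
    show "(\<lambda>\<omega>. Y u \<omega> * indicator (T u) \<omega>) \<in> borel_measurable M" by measurable
    show "AE \<omega> in M. norm (Y u \<omega> * indicator (T u) \<omega>) \<le> \<bar>C\<bar>"
      using Z_bound by eventually_elim (auto simp: Y_def indicator_def)
  qed
  define G where "G u \<omega> = Y u \<omega> * (Mem (n - 1) u \<omega> / total_mass (n - 1) \<omega>)" for u \<omega>
  have GM: "G u \<in> borel_measurable M" if "u \<in> {1..n - 1}" for u
  proof -
    have [measurable]: "Y u \<in> borel_measurable (history (n - 1))" "Mem (n - 1) u \<in> borel_measurable (history (n - 1))"
      "total_mass (n - 1) \<in> borel_measurable (history (n - 1))"
      using Y that Mem_measurable total_mass_measurable by auto
    have "G u \<in> borel_measurable (history (n - 1))" unfolding G_def by measurable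
    then show ?thesis using measurable_larger[OF _ history_le] by simp
  qed
  have AE_eq: "AE \<omega> in M. Y u \<omega> * real_cond_exp M (history (n - 1)) (indicator (T u)) \<omega> = G u \<omega>"
    if "u \<in> {1..n - 1}" for u
    using \<tau>_cond_prob[OF n that] by eventually_elim (simp add: T_def G_def total_mass_def)
  have YG: "integrable M (G u)" "expectation (\<lambda>\<omega>. Y u \<omega> * indicator (T u) \<omega>) = expectation (G u)"
    if "u \<in> {1..n - 1}" for u
  proof -
    note * = real_cond_exp_intg[OF YT[OF that] Y[OF that]]
    have meas: "(\<lambda>\<omega>. Y u \<omega> * real_cond_exp M (history (n - 1)) (indicator (T u)) \<omega>) \<in> borel_measurable M"
      using *(1) by auto
    show "integrable M (G u)"
      using *(1) integrable_cong_AE[OF meas GM[OF that] AE_eq[OF that]] by simp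
    show "expectation (\<lambda>\<omega>. Y u \<omega> * indicator (T u) \<omega>) = expectation (G u)"
      using *(2) integral_cong_AE[OF meas GM[OF that] AE_eq[OF that]] by simp
  qed
  \<comment> \<open>Exactly one of the indicators is one, that of the recalled epoch.\<close>
  have rec: "Z \<omega> * of_bool (recalled n \<omega> = k) = (\<Sum>u=1..n - 1. Y u \<omega> * indicator (T u) \<omega>)"
    if "\<omega> \<in> space M" for \<omega>
  proof -
    have "(\<Sum>u=1..n - 1. Y u \<omega> * indicator (T u) \<omega>) = (\<Sum>u=1..n - 1. if \<tau> n \<omega> = u then Y u \<omega> else 0)"
      using that by (intro sum.cong) (auto simp: T_def)
    also have "\<dots> = Y (\<tau> n \<omega>) \<omega>"
      using \<tau>_range[OF n that] by (subst sum.delta') auto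
    finally show ?thesis by (simp only: Y_def recalled_def)
  qed
  have shr: "Z \<omega> * share (n - 1) k \<omega> = (\<Sum>u=1..n - 1. G u \<omega>)" for \<omega>
    by (simp only: G_def Y_def share_def mass_def sum_divide_distrib sum_distrib_left
        times_divide_eq_right mult_ac)
  show "integrable M (\<lambda>\<omega>. Z \<omega> * share (n - 1) k \<omega>)"
    unfolding shr by (intro Bochner_Integration.integrable_sum YG(1))
  show "integrable M (\<lambda>\<omega>. Z \<omega> * of_bool (recalled n \<omega> = k))"
    using Bochner_Integration.integrable_sum[of "{1..n - 1}" M "\<lambda>u \<omega>. Y u \<omega> * indicator (T u) \<omega>"] YT
    by (subst Bochner_Integration.integrable_cong[OF refl rec]) auto
  have "expectation (\<lambda>\<omega>. Z \<omega> * of_bool (recalled n \<omega> = k)) = expectation (\<lambda>\<omega>. \<Sum>u=1..n - 1. Y u \<omega> * indicator (T u) \<omega>)"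
    by (rule Bochner_Integration.integral_cong[OF refl rec])
  also have "\<dots> = (\<Sum>u=1..n - 1. expectation (\<lambda>\<omega>. Y u \<omega> * indicator (T u) \<omega>))"
    by (rule Bochner_Integration.integral_sum[OF YT])
  also have "\<dots> = (\<Sum>u=1..n - 1. expectation (G u))"
    by (intro sum.cong refl YG(2))
  also have "\<dots> = expectation (\<lambda>\<omega>. Z \<omega> * share (n - 1) k \<omega>)"
    unfolding shr by (rule Bochner_Integration.integral_sum[OF YG(1), symmetric])
  finally show "expectation (\<lambda>\<omega>. Z \<omega> * of_bool (recalled n \<omega> = k)) = expectation (\<lambda>\<omega>. Z \<omega> * share (n - 1) k \<omega>)" .
qed

text \<open>
  The terms are martingale differences, hence uncorrelated.
\<close>

lemma recalled_share_SLLN: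
  "AE \<omega> in M. (\<lambda>n. (\<Sum>m=2..n. of_bool (recalled m \<omega> = k) - share (m - 1) k \<omega>) / real n) \<longlonglongrightarrow> 0"
proof -
  define D where "D m \<omega> = of_bool (recalled m \<omega> = k) - share (m - 1) k \<omega>" for m \<omega>
  have D_history: "D m \<in> borel_measurable (history m)" if "2 \<le> m" for m
  proof -
    have [measurable]: "recalled m \<in> measurable (history m) (count_space UNIV)"
      using that measurable_larger[OF recalled_measurable recall_le_history] by simp
    have [measurable]: "share (m - 1) k \<in> borel_measurable (history m)"
      by (rule history_measurable_mono[OF share_measurable]) simp
    show ?thesis unfolding D_def by measurable
  qed
  have D_bound: "AE \<omega> in M. \<bar>D m \<omega>\<bar> \<le> 1" for m
    using AE_share_bounds
  proof eventually_elim
    case (elim \<omega>)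
    then have "0 \<le> share (m - 1) k \<omega>" "share (m - 1) k \<omega> \<le> 1" by auto
    then show ?case by (auto simp: D_def of_bool_def)
  qed
  have "expectation (\<lambda>\<omega>. D l \<omega> * D m \<omega>) = 0" if "2 \<le> l" "l < m" for l m
  proof -
    have m: "1 < m" using that by simp
    have "D l \<in> borel_measurable (history (m - 1))"
      using D_history[OF that(1)] by (rule history_measurable_mono) (use that in simp)
    note * = expectation_recalled_eq_share[OF m this D_bound, of k]
    show ?thesis
      using *(3) unfolding D_def[of m] right_diff_distrib
      by (subst Bochner_Integration.integral_diff[OF *(1,2)]) simp
  qed
  moreover have "D m \<in> borel_measurable M" if "2 \<le> m" for m
    using measurable_larger[OF D_history[OF that] history_le] by simp
  ultimately show ?thesis
    using bounded_uncorrelated_SLLN[of 2 D 1] D_bound by (simp add: D_def)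
qed

lemma A_nth_measurable: "(\<lambda>\<omega>. A m \<omega> $ i) \<in> borel_measurable (noise_algebra m)"
  by (rule measurable_compose[OF noise_measurable(1)])
    (intro borel_measurable_continuous_onI continuous_intros)

lemma recalled_indicator_measurable:
  "1 < m \<Longrightarrow> (\<lambda>\<omega>. of_bool (recalled m \<omega> = k) :: real) \<in> borel_measurable (recall_algebra m)"
  by (rule measurable_compose[OF recalled_measurable]) simp_all

lemma A_excess_integrable:
  assumes "1 \<le> m"
  shows "integrable M (\<lambda>\<omega>. max 0 (A m \<omega> $ k - K))"
  using A_integrable[OF assms, of k] by (intro Bochner_Integration.integrable_max) auto

lemma A_function_expectation:
  fixes h :: "real \<Rightarrow> real"
  assumes "1 \<le> m" and h: "h \<in> borel_measurable borel"
  shows "distr M borel (\<lambda>\<omega>. h (A m \<omega> $ k)) = distr M borel (\<lambda>\<omega>. h (A 1 \<omega> $ k))"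
    and "expectation (\<lambda>\<omega>. h (A m \<omega> $ k)) = expectation (\<lambda>\<omega>. h (A 1 \<omega> $ k))"
proof -
  have [measurable]: "(\<lambda>y. h (y $ k)) \<in> borel_measurable (borel :: (real ^ 'd option) measure)"
    by (rule measurable_compose[OF _ h]) (intro borel_measurable_continuous_onI continuous_intros)
  have *: "distr M borel (\<lambda>\<omega>. h (A j \<omega> $ k)) = distr (distr M borel (A j)) borel (\<lambda>y. h (y $ k))"
    if "1 \<le> j" for j
    using noise_sequences_measurable(1)[OF that] by (subst distr_distr) (auto simp: comp_def)
  show "distr M borel (\<lambda>\<omega>. h (A m \<omega> $ k)) = distr M borel (\<lambda>\<omega>. h (A 1 \<omega> $ k))"
    using *[of m] *[of 1] A_ident[OF assms(1)] assms(1) by simp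
  have "expectation (\<lambda>\<omega>. h (A j \<omega> $ k)) = integral\<^sup>L (distr M borel (A j)) (\<lambda>y. h (y $ k))"
    if "1 \<le> j" for j
    using noise_sequences_measurable(1)[OF that] by (subst integral_distr) auto
  from this[of m] this[of 1] assms(1) A_ident[OF assms(1)]
  show "expectation (\<lambda>\<omega>. h (A m \<omega> $ k)) = expectation (\<lambda>\<omega>. h (A 1 \<omega> $ k))" by simp
qed

definition excess_mean :: "'d option \<Rightarrow> nat \<Rightarrow> real" where
  "excess_mean k K = expectation (\<lambda>\<omega>. max 0 (A 1 \<omega> $ k - real K))"

lemma excess_mean_tendsto: "excess_mean k \<longlonglongrightarrow> 0"
proof -
  have "excess_mean k \<longlonglongrightarrow> expectation (\<lambda>\<omega>. 0)"
    unfolding excess_mean_def[abs_def]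
  proof (rule integral_dominated_convergence)
    show "integrable M (\<lambda>\<omega>. \<bar>A 1 \<omega> $ k\<bar>)" using A_integrable[of 1 k] by simp
    show "AE \<omega> in M. (\<lambda>K. max 0 (A 1 \<omega> $ k - real K)) \<longlonglongrightarrow> 0"
    proof (rule AE_I2)
      fix \<omega>
      obtain K0 :: nat where K0: "A 1 \<omega> $ k \<le> real K0" using real_arch_simple by blast
      have "\<forall>\<^sub>F K in sequentially. max 0 (A 1 \<omega> $ k - real K) = 0"
        using eventually_ge_at_top[of K0] by (rule eventually_mono) (use K0 in auto)
      then show "(\<lambda>K. max 0 (A 1 \<omega> $ k - real K)) \<longlonglongrightarrow> 0"
        by (rule tendsto_eventually)
    qed
    show "AE \<omega> in M. norm (max 0 (A 1 \<omega> $ k - real K)) \<le> \<bar>A 1 \<omega> $ k\<bar>" for K by auto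
    show "(\<lambda>\<omega>. max 0 (A 1 \<omega> $ k - real K)) \<in> borel_measurable M" for K
      using A_excess_integrable[of 1 k "real K"] by auto
  qed simp
  then show ?thesis by simp
qed

lemma truncated_mean:
  assumes "1 \<le> m"
  shows "expectation (\<lambda>\<omega>. max 0 (min (real K) (A m \<omega> $ k))) = a - excess_mean k K"
proof -
  have "expectation (\<lambda>\<omega>. max 0 (min (real K) (A m \<omega> $ k)))
      = expectation (\<lambda>\<omega>. A m \<omega> $ k - max 0 (A m \<omega> $ k - real K))"
  proof (rule integral_cong_AE)
    have [measurable]: "(\<lambda>\<omega>. A m \<omega> $ k) \<in> borel_measurable M" using A_integrable[OF assms] by auto
    show "(\<lambda>\<omega>. max 0 (min (real K) (A m \<omega> $ k))) \<in> borel_measurable M"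
      "(\<lambda>\<omega>. A m \<omega> $ k - max 0 (A m \<omega> $ k - real K)) \<in> borel_measurable M" by measurable
    show "AE \<omega> in M. max 0 (min (real K) (A m \<omega> $ k)) = A m \<omega> $ k - max 0 (A m \<omega> $ k - real K)"
      using A_nonneg[OF assms, of k] by eventually_elim auto
  qed
  also have "\<dots> = a - expectation (\<lambda>\<omega>. max 0 (A m \<omega> $ k - real K))"
    using A_integrable[OF assms] A_excess_integrable[OF assms] A_mean[OF assms] by simp
  also have "expectation (\<lambda>\<omega>. max 0 (A m \<omega> $ k - real K)) = excess_mean k K"
    unfolding excess_mean_def using A_function_expectation(2)[OF assms, of "\<lambda>y. max 0 (y - real K)"] by simp
  finally show ?thesis .
qed

lemma excess_sum_bound:
  assumes "0 < e"
  shows "AE \<omega> in M. \<forall>\<^sub>F n in sequentially.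
    (\<Sum>m=1..n. max 0 (A m \<omega> $ k - real K)) \<le> (2 * excess_mean k K + e) * real n"
  unfolding excess_mean_def
proof (rule pairwise_iid_sum_bound)
  show "indep_var borel (\<lambda>\<omega>. max 0 (A l \<omega> $ k - real K)) borel (\<lambda>\<omega>. max 0 (A m \<omega> $ k - real K))"
    if "1 \<le> l" "l < m" for l m
  proof -
    define h where "h y = max 0 (y $ k - real K)" for y :: "real ^ 'd option"
    have h: "h \<in> borel_measurable borel"
      unfolding h_def by (intro borel_measurable_continuous_onI continuous_intros)
    have "indep_var borel (A l) borel (A m)"
      using that by (intro indep_vars_pair[OF A_indep]) auto
    from indep_var_compose[OF this h h] show ?thesis by (simp add: comp_def h_def)
  qed
  show "distr M borel (\<lambda>\<omega>. max 0 (A m \<omega> $ k - real K)) = distr M borel (\<lambda>\<omega>. max 0 (A 1 \<omega> $ k - real K))"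
    if "1 \<le> m" for m
    by (rule A_function_expectation(1)[OF that]) measurable
qed (use assms A_excess_integrable in simp_all)

text \<open>
  Split \<open>A m $ k - a\<close> into the centred truncation at \<open>K\<close> and the centred excess over \<open>K\<close>. The truncated part averages
  to zero for every \<open>K\<close>. The excess contributes at most about three times its mean: twice from
  \<open>pairwise_iid_sum_bound\<close> and once from the centring. Letting \<open>K\<close> grow removes it.
\<close>

lemma reinforcement_SLLN:
  "AE \<omega> in M. (\<lambda>n. (\<Sum>m=2..n. of_bool (recalled m \<omega> = k) * (A m \<omega> $ k - a)) / real n) \<longlonglongrightarrow> 0"
proof -
  define \<delta> where "\<delta> = excess_mean k"
  define b where "b K m \<omega> = max 0 (min (real K) (A m \<omega> $ k))" for K m \<omega>
  define x where "x K m \<omega> = max 0 (A m \<omega> $ k - real K)" for K m \<omega>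
  have "AE \<omega> in M. (\<lambda>n. (\<Sum>m=2..n. of_bool (recalled m \<omega> = k) * (b K m \<omega> - (a - \<delta> K))) / real n) \<longlonglongrightarrow> 0" for K
  proof (rule weighted_noise_SLLN)
    show "b K m \<in> borel_measurable (noise_algebra m)" for m
      unfolding b_def using A_nth_measurable[of m k] by measurable
    show "\<bar>b K m \<omega>\<bar> \<le> real K" for m \<omega> by (auto simp: b_def)
    show "expectation (b K m) = a - \<delta> K" if "1 < m" for m
      unfolding b_def \<delta>_def using that by (intro truncated_mean) simp
  qed (use recalled_indicator_measurable in auto)
  then have ae1: "AE \<omega> in M. \<forall>K. (\<lambda>n. (\<Sum>m=2..n. of_bool (recalled m \<omega> = k) * (b K m \<omega> - (a - \<delta> K))) / real n) \<longlonglongrightarrow> 0"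
    by (simp add: AE_all_countable)
  have ae2: "AE \<omega> in M. \<forall>K. \<forall>\<^sub>F n in sequentially. (\<Sum>m=1..n. x K m \<omega>) \<le> (2 * \<delta> K + inverse (real (Suc K))) * real n"
    unfolding AE_all_countable x_def \<delta>_def by (intro allI excess_sum_bound) simp
  have \<delta>_nonneg: "0 \<le> \<delta> K" for K
    unfolding \<delta>_def excess_mean_def by (intro Bochner_Integration.integral_nonneg) simp
  show ?thesis
    using ae1 ae2 AE_A_nonneg
  proof eventually_elim
    case (elim \<omega>)
    let ?S = "\<lambda>n. (\<Sum>m=2..n. of_bool (recalled m \<omega> = k) * (A m \<omega> $ k - a)) / real n"
    let ?B = "\<lambda>K n. (\<Sum>m=2..n. of_bool (recalled m \<omega> = k) * (b K m \<omega> - (a - \<delta> K))) / real n"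
    show "?S \<longlonglongrightarrow> 0"
    proof (rule tendstoI)
      fix e :: real assume e: "0 < e"
      have "(\<lambda>K. 3 * \<delta> K + inverse (real (Suc K))) \<longlonglongrightarrow> 3 * 0 + 0"
        unfolding \<delta>_def by (intro tendsto_intros excess_mean_tendsto LIMSEQ_inverse_real_of_nat)
      then have "\<forall>\<^sub>F K in sequentially. 3 * \<delta> K + inverse (real (Suc K)) < e / 2"
        by (rule order_tendstoD(2)) (use e in simp)
      then obtain K where K: "3 * \<delta> K + inverse (real (Suc K)) < e / 2"
        by (auto simp: eventually_sequentially)
      have "\<forall>\<^sub>F n in sequentially. \<bar>?B K n\<bar> < e / 2"
        using tendstoD[OF elim(1)[rule_format], of "e / 2"] e by (simp add: dist_real_def)
      then show "\<forall>\<^sub>F n in sequentially. dist (?S n) 0 < e"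
        using elim(2)[rule_format, of K] eventually_gt_at_top[of "0 :: nat"]
      proof eventually_elim
        case (elim n)
        have split: "A m \<omega> $ k - a = (b K m \<omega> - (a - \<delta> K)) + (x K m \<omega> - \<delta> K)" if "m \<in> {2..n}" for m
        proof -
          have "0 \<le> A m \<omega> $ k" using \<open>\<forall>m\<ge>1. \<forall>i. 0 \<le> A m \<omega> $ i\<close> that by simp
          then show ?thesis by (simp add: b_def x_def max_def min_def)
        qed
        define R where "R = (\<Sum>m=2..n. of_bool (recalled m \<omega> = k) * (x K m \<omega> - \<delta> K))"
        have "?S n = ?B K n + R / real n"
          unfolding add_divide_distrib[symmetric] R_def sum.distrib[symmetric] distrib_left[symmetric]
          by (intro arg_cong[of _ _ "\<lambda>s. s / real n"] sum.cong refl) (simp only: split)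
        have x0: "0 \<le> x K m \<omega>" for m by (simp add: x_def)
        have "\<bar>R\<bar> \<le> (\<Sum>m=2..n. \<bar>of_bool (recalled m \<omega> = k) * (x K m \<omega> - \<delta> K)\<bar>)"
          unfolding R_def by (rule sum_abs)
        also have "\<dots> \<le> (\<Sum>m=2..n. x K m \<omega> + \<delta> K)"
          using x0 \<delta>_nonneg[of K] by (intro sum_mono) (auto simp: of_bool_def abs_le_iff add_increasing)
        also have "\<dots> \<le> (\<Sum>m=1..n. x K m \<omega> + \<delta> K)"
          using x0 \<delta>_nonneg by (intro sum_mono2) auto
        also have "\<dots> = (\<Sum>m=1..n. x K m \<omega>) + \<delta> K * real n"
          by (simp add: sum.distrib)
        also have "\<dots> \<le> (3 * \<delta> K + inverse (real (Suc K))) * real n"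
          using elim(2) by (simp add: algebra_simps)
        also have "\<dots> \<le> e / 2 * real n"
          using K by (intro mult_right_mono) auto
        finally have "\<bar>R / real n\<bar> \<le> e / 2"
          using elim(3) by (simp add: field_simps)
        then have "\<bar>?B K n + R / real n\<bar> < e"
          using elim(1) by linarith
        then show ?case
          using \<open>?S n = ?B K n + R / real n\<close> by (simp add: dist_real_def)
      qed
    qed
  qed
qed

definition step_prob :: "'d option \<Rightarrow> real" where
  "step_prob k = (case k of None \<Rightarrow> 1 - p | Some _ \<Rightarrow> p / real CARD('d))"

lemma rest_step_SLLN:
  "AE \<omega> in M. (\<lambda>n. (\<Sum>m=2..n. of_bool (recalled m \<omega> = None) * (of_bool (I m \<omega> = k) - step_prob k)) / real n) \<longlonglongrightarrow> 0"
proof (rule weighted_noise_SLLN)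
  show "expectation (\<lambda>\<omega>. of_bool (I m \<omega> = k)) = step_prob k" if "1 < m" for m
  proof -
    have "expectation (\<lambda>\<omega>. of_bool (I m \<omega> = k)) = expectation (indicator {\<omega> \<in> space M. I m \<omega> = k})"
      by (intro Bochner_Integration.integral_cong) (auto simp: indicator_def)
    also have "\<dots> = prob {\<omega> \<in> space M. I m \<omega> = k}"
      by (simp add: Int_absorb2)
    also have "\<dots> = step_prob k"
      using I_prob_None[of m] I_prob_Some[of m] that by (cases k) (simp_all add: step_prob_def)
    finally show ?thesis .
  qed
  show "(\<lambda>\<omega>. of_bool (I m \<omega> = k) :: real) \<in> borel_measurable (noise_algebra m)" for m
    by (rule measurable_compose[OF noise_measurable(2)]) simp_all
qed (use recalled_indicator_measurable in \<open>auto intro: order_refl\<close>)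

text \<open>
  The set \<open>T\<close> is a single coordinate when that coordinate is counted, and all coordinates when rest is counted.
\<close>

lemma move_step_SLLN:
  "AE \<omega> in M. (\<lambda>n. (\<Sum>m=2..n. of_bool (recalled m \<omega> \<in> T) * (of_bool (J m \<omega>) - (1 - q))) / real n) \<longlonglongrightarrow> 0"
proof (rule weighted_noise_SLLN)
  show "expectation (\<lambda>\<omega>. of_bool (J m \<omega>)) = 1 - q" if "1 < m" for m
  proof -
    have "expectation (\<lambda>\<omega>. of_bool (J m \<omega>)) = expectation (indicator {\<omega> \<in> space M. J m \<omega>})"
      by (intro Bochner_Integration.integral_cong) (auto simp: indicator_def)
    also have "\<dots> = 1 - q" using J_prob_True[of m] that by (simp add: Int_absorb2)
    finally show ?thesis .
  qed
  show "(\<lambda>\<omega>. of_bool (J m \<omega>) :: real) \<in> borel_measurable (noise_algebra m)" for m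
    by (rule measurable_compose[OF noise_measurable(3)]) simp_all
  show "(\<lambda>\<omega>. of_bool (recalled m \<omega> \<in> T) :: real) \<in> borel_measurable (recall_algebra m)" if "1 < m" for m
    by (rule measurable_compose[OF recalled_measurable[OF that]]) simp_all
qed (auto intro: order_refl)

end

section \<open>Convergence of the frequencies\<close>

context delayed_erw
begin

definition recall_freq :: "nat \<Rightarrow> 'd option \<Rightarrow> 'w \<Rightarrow> real" where
  "recall_freq n k \<omega> = (\<Sum>m=2..n. of_bool (recalled m \<omega> = k)) / real n"

definition colour_freq :: "nat \<Rightarrow> 'd option \<Rightarrow> 'w \<Rightarrow> real" where
  "colour_freq n k \<omega> = (\<Sum>m=1..n. of_bool (colour m \<omega> = k)) / real n"

lemma recall_freq_bound: "\<bar>recall_freq n k \<omega>\<bar> \<le> 1"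
proof -
  have "(\<Sum>m=2..n. of_bool (recalled m \<omega> = k)) \<le> (\<Sum>m=2..n. 1 :: real)"
    by (intro sum_mono) auto
  also have "\<dots> \<le> real n" by simp
  finally have "(\<Sum>m=2..n. of_bool (recalled m \<omega> = k)) \<le> real n" .
  moreover have "0 \<le> (\<Sum>m=2..n. of_bool (recalled m \<omega> = k) :: real)"
    by (intro sum_nonneg) auto
  ultimately show ?thesis
    unfolding recall_freq_def by (simp only: abs_divide abs_of_nonneg abs_of_nat divide_le_eq_1) auto
qed

text \<open>
  A rest occurs either after a recalled rest, if \<open>I\<close> chooses it, or after a recalled move, if \<open>J\<close> fails. Centring both
  events leaves \<open>(1 - p) * r + q * (1 - r)\<close>, where \<open>r\<close> is the frequency of recalled rests.
\<close>

lemma colour_freq_None: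
  "AE \<omega> in M. (\<lambda>n. colour_freq n None \<omega> - ((1 - p - q) * recall_freq n None \<omega> + q)) \<longlonglongrightarrow> 0"
  using rest_step_SLLN[of None] move_step_SLLN[of "- {None}"] AE_space
proof eventually_elim
  case (elim \<omega>)
  let ?F = "\<lambda>n. (\<Sum>m=2..n. of_bool (recalled m \<omega> = None) * (of_bool (I m \<omega> = None) - step_prob None)) / real n"
  let ?G = "\<lambda>n. (\<Sum>m=2..n. of_bool (recalled m \<omega> \<in> - {None}) * (of_bool (J m \<omega>) - (1 - q))) / real n"
  have "(\<lambda>n. ?F n - ?G n + (of_bool (colour 1 \<omega> = None) - q) / real n) \<longlonglongrightarrow> 0 - 0 + 0"
    by (intro tendsto_add tendsto_diff elim(1,2) lim_const_over_n)
  then have "(\<lambda>n. ?F n - ?G n + (of_bool (colour 1 \<omega> = None) - q) / real n) \<longlonglongrightarrow> 0"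
    by simp
  then show ?case
  proof (rule tendsto_0_cong_from_1)
    fix n :: nat assume n: "1 \<le> n"
    have "of_bool (colour m \<omega> = None) = of_bool (recalled m \<omega> = None) * (of_bool (I m \<omega> = None) - step_prob None)
        - of_bool (recalled m \<omega> \<in> - {None}) * (of_bool (J m \<omega>) - (1 - q))
        + ((1 - p - q) * of_bool (recalled m \<omega> = None) + q)" if "m \<in> {2..n}" for m
      using that colour_next[of m \<omega>] elim(3)
      by (cases "recalled m \<omega>") (auto simp: next_colour_def step_prob_def)
    then have "(\<Sum>m=2..n. of_bool (colour m \<omega> = None)) =
        (\<Sum>m=2..n. of_bool (recalled m \<omega> = None) * (of_bool (I m \<omega> = None) - step_prob None))
      - (\<Sum>m=2..n. of_bool (recalled m \<omega> \<in> - {None}) * (of_bool (J m \<omega>) - (1 - q)))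
      + ((1 - p - q) * (\<Sum>m=2..n. of_bool (recalled m \<omega> = None)) + (real n - 1) * q)"
      using n by (simp add: sum.distrib sum_subtractf sum_distrib_left of_nat_diff)
    moreover have "(x + (f - g + (y * r + (real n - 1) * q))) / real n - (y * (r / real n) + q)
        = f / real n - g / real n + (x - q) / real n" for x f g y r
      using n by (simp add: field_simps)
    ultimately show "colour_freq n None \<omega> - ((1 - p - q) * recall_freq n None \<omega> + q)
        = ?F n - ?G n + (of_bool (colour 1 \<omega> = None) - q) / real n"
      unfolding colour_freq_def recall_freq_def sum_from_1[OF n] by (simp only:)
  qed
qed

text \<open>
  A move in direction \<open>c\<close> occurs either after a recalled rest, if \<open>I\<close> chooses it, or after a recalled move in the same
  direction, if \<open>J\<close> succeeds.
\<close>

lemma colour_freq_Some: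
  "AE \<omega> in M. (\<lambda>n. colour_freq n (Some c) \<omega>
     - (p / real CARD('d) * recall_freq n None \<omega> + (1 - q) * recall_freq n (Some c) \<omega>)) \<longlonglongrightarrow> 0"
  using rest_step_SLLN[of "Some c"] move_step_SLLN[of "{Some c}"] AE_space
proof eventually_elim
  case (elim \<omega>)
  let ?F = "\<lambda>n. (\<Sum>m=2..n. of_bool (recalled m \<omega> = None) * (of_bool (I m \<omega> = Some c) - step_prob (Some c))) / real n"
  let ?G = "\<lambda>n. (\<Sum>m=2..n. of_bool (recalled m \<omega> \<in> {Some c}) * (of_bool (J m \<omega>) - (1 - q))) / real n"
  have "(\<lambda>n. ?F n + ?G n + of_bool (colour 1 \<omega> = Some c) / real n) \<longlonglongrightarrow> 0 + 0 + 0"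
    by (intro tendsto_add elim(1,2) lim_const_over_n)
  then have "(\<lambda>n. ?F n + ?G n + of_bool (colour 1 \<omega> = Some c) / real n) \<longlonglongrightarrow> 0"
    by simp
  then show ?case
  proof (rule tendsto_0_cong_from_1)
    fix n :: nat assume n: "1 \<le> n"
    have "of_bool (colour m \<omega> = Some c) = of_bool (recalled m \<omega> = None) * (of_bool (I m \<omega> = Some c) - step_prob (Some c))
        + of_bool (recalled m \<omega> \<in> {Some c}) * (of_bool (J m \<omega>) - (1 - q))
        + (p / real CARD('d) * of_bool (recalled m \<omega> = None) + (1 - q) * of_bool (recalled m \<omega> = Some c))"
      if "m \<in> {2..n}" for m
      using that colour_next[of m \<omega>] elim(3)
      by (cases "recalled m \<omega>") (auto simp: next_colour_def step_prob_def)
    then have "(\<Sum>m=2..n. of_bool (colour m \<omega> = Some c)) =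
        (\<Sum>m=2..n. of_bool (recalled m \<omega> = None) * (of_bool (I m \<omega> = Some c) - step_prob (Some c)))
      + (\<Sum>m=2..n. of_bool (recalled m \<omega> \<in> {Some c}) * (of_bool (J m \<omega>) - (1 - q)))
      + (p / real CARD('d) * (\<Sum>m=2..n. of_bool (recalled m \<omega> = None))
          + (1 - q) * (\<Sum>m=2..n. of_bool (recalled m \<omega> = Some c)))"
      by (simp only: sum.distrib sum_distrib_left cong: sum.cong)
    then show "colour_freq n (Some c) \<omega>
     - (p / real CARD('d) * recall_freq n None \<omega> + (1 - q) * recall_freq n (Some c) \<omega>)
        = ?F n + ?G n + of_bool (colour 1 \<omega> = Some c) / real n"
      unfolding colour_freq_def recall_freq_def sum_from_1[OF n]
      by (simp only: add_divide_distrib) simp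
  qed
qed

lemma mass_average:
  "AE \<omega> in M. (\<lambda>n. mass n k \<omega> / real n - (colour_freq n k \<omega> + a * recall_freq n k \<omega>)) \<longlonglongrightarrow> 0"
  using reinforcement_SLLN[of k] AE_space
proof eventually_elim
  case (elim \<omega>)
  from elim(1) show ?case
  proof (rule tendsto_0_cong_from_1)
    fix n :: nat assume n: "1 \<le> n"
    show "mass n k \<omega> / real n - (colour_freq n k \<omega> + a * recall_freq n k \<omega>)
      = (\<Sum>m=2..n. of_bool (recalled m \<omega> = k) * (A m \<omega> $ k - a)) / real n"
      unfolding mass_eq[OF elim(2) n] colour_freq_def recall_freq_def right_diff_distrib sum_subtractf
      by (simp only: add_divide_distrib diff_divide_distrib sum_distrib_right[symmetric]) simp
  qed
qed

text \<open>
  Sum \<open>mass_average\<close> over the colours. The colour frequencies add up to one, the recall frequencies to \<open>(n - 1) / n\<close>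
  since there is no recall at the first epoch.
\<close>

lemma total_mass_average: "AE \<omega> in M. (\<lambda>n. total_mass n \<omega> / real n) \<longlonglongrightarrow> 1 + a"
proof -
  have "AE \<omega> in M. \<forall>k. (\<lambda>n. mass n k \<omega> / real n - (colour_freq n k \<omega> + a * recall_freq n k \<omega>)) \<longlonglongrightarrow> 0"
    unfolding AE_all_countable using mass_average by blast
  then show ?thesis
  proof eventually_elim
    case (elim \<omega>)
    let ?E = "\<lambda>n k. mass n k \<omega> / real n - (colour_freq n k \<omega> + a * recall_freq n k \<omega>)"
    have "(\<lambda>n. (\<Sum>k\<in>UNIV. ?E n k) - a / real n) \<longlonglongrightarrow> (\<Sum>k\<in>(UNIV :: 'd option set). 0) - 0"
      using elim by (intro tendsto_diff tendsto_sum lim_const_over_n) auto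
    then have "(\<lambda>n. (\<Sum>k\<in>UNIV. ?E n k) - a / real n) \<longlonglongrightarrow> 0" by simp
    then have "(\<lambda>n. total_mass n \<omega> / real n - (1 + a)) \<longlonglongrightarrow> 0"
    proof (rule tendsto_0_cong_from_1)
      fix n :: nat assume n: "1 \<le> n"
      have "(\<Sum>k\<in>UNIV. colour_freq n k \<omega>) = 1"
        unfolding colour_freq_def sum_divide_distrib[symmetric]
        by (subst sum.swap) (use n in \<open>simp add: of_bool_def\<close>)
      moreover have "(\<Sum>k\<in>UNIV. recall_freq n k \<omega>) = (real n - 1) / real n"
        unfolding recall_freq_def sum_divide_distrib[symmetric]
        by (subst sum.swap) (use n in \<open>simp add: of_bool_def of_nat_diff\<close>)
      moreover have "(\<Sum>k\<in>UNIV. ?E n k) = total_mass n \<omega> / real n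
          - ((\<Sum>k\<in>UNIV. colour_freq n k \<omega>) + a * (\<Sum>k\<in>UNIV. recall_freq n k \<omega>))"
        by (simp add: total_mass_eq sum_subtractf sum.distrib sum_distrib_left sum_divide_distrib)
      moreover have "x - (1 + a) = (x - (1 + a * ((real n - 1) / real n))) - a / real n" for x
        using n by (simp add: field_simps)
      ultimately show "total_mass n \<omega> / real n - (1 + a) = (\<Sum>k\<in>UNIV. ?E n k) - a / real n"
        by (simp only:)
    qed
    then show ?case by (rule LIM_zero_cancel)
  qed
qed

lemma recall_freq_share:
  "AE \<omega> in M. (\<lambda>n. recall_freq n k \<omega> - (\<Sum>m=2..n. share (m - 1) k \<omega>) / real n) \<longlonglongrightarrow> 0"
  using recalled_share_SLLN[of k]
  by (simp add: recall_freq_def sum_subtractf diff_divide_distrib)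

lemma share_eq: "share n k \<omega> = (mass n k \<omega> / real n) / (total_mass n \<omega> / real n)" if "1 \<le> n"
  using that by (simp add: share_def)

text \<open>
  Rest can be treated first because its frequencies do not depend on those of the individual coordinates.
\<close>

lemma recall_freq_None_tendsto:
  assumes a: "0 < a" and pq: "0 < p" "p < 1" "0 < q" "q < 1"
  shows "AE \<omega> in M. (\<lambda>n. recall_freq n None \<omega>) \<longlonglongrightarrow> q / (p + q)"
  using colour_freq_None mass_average[of None] total_mass_average recall_freq_share[of None]
proof eventually_elim
  case (elim \<omega>)
  define b where "b n = (1 - p - q + a) * recall_freq n None \<omega> + q" for n
  have "(\<lambda>n. mass n None \<omega> / real n - b n) \<longlonglongrightarrow> 0"
    using tendsto_add[OF elim(1,2)] by (simp add: b_def algebra_simps)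
  moreover have "\<bar>b n\<bar> \<le> \<bar>1 - p - q + a\<bar> * 1 + q" for n
  proof -
    have "\<bar>b n\<bar> \<le> \<bar>1 - p - q + a\<bar> * \<bar>recall_freq n None \<omega>\<bar> + \<bar>q\<bar>"
      unfolding b_def abs_mult[symmetric] by (rule abs_triangle_ineq)
    also have "\<dots> \<le> \<bar>1 - p - q + a\<bar> * 1 + q"
      using recall_freq_bound pq by (intro add_mono mult_left_mono) auto
    finally show ?thesis .
  qed
  ultimately have "(\<lambda>n. (mass n None \<omega> / real n) / (total_mass n \<omega> / real n) - b n / (1 + a)) \<longlonglongrightarrow> 0"
    using a by (intro tendsto_divide_approx[OF _ _ elim(3)]) auto
  then have "(\<lambda>n. share n None \<omega> - ((1 - p - q + a) / (1 + a) * recall_freq n None \<omega> + q / (1 + a))) \<longlonglongrightarrow> 0"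
    by (rule tendsto_0_cong_from_1) (simp only: share_eq b_def affine_divide)
  moreover have "\<bar>(1 - p - q + a) / (1 + a)\<bar> < 1"
    using a pq by (simp add: abs_less_iff field_simps)
  ultimately have "(\<lambda>n. recall_freq n None \<omega>) \<longlonglongrightarrow> (q / (1 + a)) / (1 - (1 - p - q + a) / (1 + a))"
    by (intro average_fixed_point[OF recall_freq_bound _ _ elim(4)])
  also have "1 - (1 - p - q + a) / (1 + a) = (p + q) / (1 + a)"
    using a by (simp add: field_simps)
  also have "(q / (1 + a)) / ((p + q) / (1 + a)) = q / (p + q)"
    using a by simp
  finally show ?case .
qed

text \<open>
  The recalled rests enter as an inflow whose rate is already known to converge, so this is again a scalar
  contraction.
\<close>

lemma recall_freq_Some_tendsto:
  assumes a: "0 < a" and pq: "0 < p" "p < 1" "0 < q" "q < 1"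
  shows "AE \<omega> in M. (\<lambda>n. recall_freq n (Some c) \<omega>) \<longlonglongrightarrow> p / (real CARD('d) * (p + q))"
  using colour_freq_Some[of c] mass_average[of "Some c"] total_mass_average
    recall_freq_share[of "Some c"] recall_freq_None_tendsto[OF assms]
proof eventually_elim
  case (elim \<omega>)
  define s where "s = p / real CARD('d) * (q / (p + q))"
  have s: "0 \<le> s" using pq by (simp add: s_def)
  define b where "b n = (1 - q + a) * recall_freq n (Some c) \<omega> + s" for n
  \<comment> \<open>Replace the frequency of recalled rests by its limit, at the cost of a vanishing error.\<close>
  have "(\<lambda>n. p / real CARD('d) * (recall_freq n None \<omega> - q / (p + q))) \<longlonglongrightarrow> p / real CARD('d) * 0"
    by (intro tendsto_mult_left LIM_zero elim(5))
  then have "(\<lambda>n. p / real CARD('d) * (recall_freq n None \<omega> - q / (p + q))) \<longlonglongrightarrow> 0" by simp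
  from tendsto_add[OF tendsto_add[OF elim(1,2)] this]
  have "(\<lambda>n. mass n (Some c) \<omega> / real n - b n) \<longlonglongrightarrow> 0"
    by (simp add: b_def s_def algebra_simps)
  moreover have "\<bar>b n\<bar> \<le> (1 - q + a) * 1 + s" for n
  proof -
    have "\<bar>b n\<bar> \<le> \<bar>1 - q + a\<bar> * \<bar>recall_freq n (Some c) \<omega>\<bar> + \<bar>s\<bar>"
      unfolding b_def abs_mult[symmetric] by (rule abs_triangle_ineq)
    also have "\<dots> \<le> (1 - q + a) * 1 + s"
      using recall_freq_bound pq a s by (intro add_mono mult_mono) auto
    finally show ?thesis .
  qed
  ultimately have "(\<lambda>n. (mass n (Some c) \<omega> / real n) / (total_mass n \<omega> / real n) - b n / (1 + a)) \<longlonglongrightarrow> 0"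
    using a by (intro tendsto_divide_approx[OF _ _ elim(3)]) auto
  then have "(\<lambda>n. share n (Some c) \<omega> - ((1 - q + a) / (1 + a) * recall_freq n (Some c) \<omega> + s / (1 + a))) \<longlonglongrightarrow> 0"
    by (rule tendsto_0_cong_from_1) (simp only: share_eq b_def affine_divide)
  moreover have "\<bar>(1 - q + a) / (1 + a)\<bar> < 1"
    using a pq by (simp add: abs_less_iff field_simps)
  ultimately have "(\<lambda>n. recall_freq n (Some c) \<omega>) \<longlonglongrightarrow> (s / (1 + a)) / (1 - (1 - q + a) / (1 + a))"
    by (intro average_fixed_point[OF recall_freq_bound _ _ elim(4)])
  also have "1 - (1 - q + a) / (1 + a) = q / (1 + a)"
    using a by (simp add: field_simps)
  also have "(s / (1 + a)) / (q / (1 + a)) = s / q"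
    using a by simp
  also have "\<dots> = p / (real CARD('d) * (p + q))"
    using pq by (simp add: s_def)
  finally show ?case .
qed

lemma colour_freq_Some_tendsto:
  assumes a: "0 < a" and pq: "0 < p" "p < 1" "0 < q" "q < 1"
  shows "AE \<omega> in M. (\<lambda>n. colour_freq n (Some c) \<omega>) \<longlonglongrightarrow> p / (real CARD('d) * (p + q))"
  using colour_freq_Some[of c] recall_freq_None_tendsto[OF assms] recall_freq_Some_tendsto[OF assms, of c]
proof eventually_elim
  case (elim \<omega>)
  let ?r = "p / (real CARD('d) * (p + q))"
  let ?b = "\<lambda>n. p / real CARD('d) * recall_freq n None \<omega> + (1 - q) * recall_freq n (Some c) \<omega>"
  have "(\<lambda>n. (colour_freq n (Some c) \<omega> - ?b n) + ?b n) \<longlonglongrightarrow>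
      0 + (p / real CARD('d) * (q / (p + q)) + (1 - q) * ?r)"
    by (intro tendsto_add tendsto_mult_left elim)
  moreover have "p / real CARD('d) * (q / (p + q)) = q * ?r" by simp
  moreover have "q * ?r + (1 - q) * ?r = ?r" by (simp only: distrib_right[symmetric]) simp
  ultimately show ?case by (simp only: diff_add_cancel add_0)
qed

lemma L_eq: "\<omega> \<in> space M \<Longrightarrow> L n \<omega> = (\<Sum>m=1..n. coord_vec (colour m \<omega>))"
proof (induction n)
  case 0
  then show ?case using L_0 by (simp add: coord_vec_def)
next
  case (Suc n)
  then show ?case using L_step[of "Suc n" \<omega>] X_eq[of "Suc n" \<omega>] by simp
qed

lemma L_measurable: "L n \<in> borel_measurable M"
proof -
  have "(\<lambda>\<omega>. \<Sum>m=1..n. coord_vec (colour m \<omega>)) \<in> borel_measurable M"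
  proof (rule borel_measurable_sum)
    fix m assume "m \<in> {1..n}"
    then have "colour m \<in> measurable M (count_space UNIV)"
      using measurable_larger[OF colour_measurable history_le] by simp
    then show "(\<lambda>\<omega>. coord_vec (colour m \<omega>)) \<in> borel_measurable M"
      by (rule measurable_compose) simp
  qed
  then show ?thesis
    by (rule measurable_cong[THEN iffD1, rotated]) (simp add: L_eq)
qed

lemma norm_L_le:
  assumes "\<omega> \<in> space M" shows "norm (L n \<omega>) \<le> real n"
proof -
  have "norm (coord_vec k) \<le> 1" for k :: "'d option"
    by (cases k) (auto simp: coord_vec_def)
  then have "norm (L n \<omega>) \<le> (\<Sum>m=1..n. 1)"
    unfolding L_eq[OF assms] by (intro sum_norm_le)
  then show ?thesis by simp
qed

lemma L_integrable: "integrable M (L n)"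
  using norm_L_le L_measurable by (intro integrable_const_bound[of _ "real n"]) auto

lemma L_average_AE:
  assumes "0 < a" "0 < p" "p < 1" "0 < q" "q < 1"
  shows "AE \<omega> in M. (\<lambda>n. (1 / real n) *\<^sub>R L n \<omega>) \<longlonglongrightarrow> (p / (real CARD('d) * (p + q))) *\<^sub>R (\<chi> i. 1)"
proof -
  have "AE \<omega> in M. \<forall>c. (\<lambda>n. colour_freq n (Some c) \<omega>) \<longlonglongrightarrow> p / (real CARD('d) * (p + q))"
    unfolding AE_all_countable using colour_freq_Some_tendsto[OF assms] by blast
  then show ?thesis
    using AE_space
  proof eventually_elim
    case (elim \<omega>)
    have "((1 / real n) *\<^sub>R L n \<omega>) $ c = colour_freq n (Some c) \<omega>" for n c
      using elim(2) by (simp add: L_eq colour_freq_def coord_vec_nth)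
    then show ?case
      using elim(1) by (intro vec_tendstoI) simp
  qed
qed

end

theorem theorem4p1:
  fixes M :: "'w measure"
    and A :: "nat \<Rightarrow> 'w \<Rightarrow> real ^ ('d::finite option)"
    and I :: "nat \<Rightarrow> 'w \<Rightarrow> 'd option"
    and J :: "nat \<Rightarrow> 'w \<Rightarrow> bool"
    and U :: "'w \<Rightarrow> real ^ 'd"
    and \<tau> :: "nat \<Rightarrow> 'w \<Rightarrow> nat"
    and Mem :: "nat \<Rightarrow> nat \<Rightarrow> 'w \<Rightarrow> real"
    and X L :: "nat \<Rightarrow> 'w \<Rightarrow> real ^ 'd"
    and a p q :: real
  assumes "a > 0" and "0 < p" "p < 1" and "0 < q" "q < 1"
    and "delayed_erw M A I J U \<tau> Mem X L a p q"
  defines "c \<equiv> (p / (real CARD('d) * (p + q))) *\<^sub>R ((\<chi> i. 1) :: real ^ 'd)"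
  shows "(AE \<omega> in M. (\<lambda>n. (1 / real n) *\<^sub>R L n \<omega>) \<longlonglongrightarrow> c)
       \<and> (\<forall>n. integrable M (L n))
       \<and> (\<lambda>n. \<integral>\<omega>. norm ((1 / real n) *\<^sub>R L n \<omega> - c) \<partial>M) \<longlonglongrightarrow> 0"
proof -
  interpret delayed_erw M A I J U \<tau> Mem X L a p q by fact
  have ae: "AE \<omega> in M. (\<lambda>n. (1 / real n) *\<^sub>R L n \<omega>) \<longlonglongrightarrow> c"
    unfolding c_def using assms(1-5) by (rule L_average_AE)
  have "(\<lambda>n. \<integral>\<omega>. norm ((1 / real n) *\<^sub>R L n \<omega> - c) \<partial>M) \<longlonglongrightarrow> (\<integral>\<omega>. 0 \<partial>M)"
  proof (rule integral_dominated_convergence)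
    show "AE \<omega> in M. (\<lambda>n. norm ((1 / real n) *\<^sub>R L n \<omega> - c)) \<longlonglongrightarrow> 0"
      using ae by eventually_elim (rule tendsto_norm_zero[OF LIM_zero])
    show "AE \<omega> in M. norm (norm ((1 / real n) *\<^sub>R L n \<omega> - c)) \<le> 1 + norm c" for n
    proof (rule AE_I2)
      fix \<omega> assume "\<omega> \<in> space M"
      then have "norm ((1 / real n) *\<^sub>R L n \<omega>) \<le> 1"
        using norm_L_le[of \<omega> n] by (cases "n = 0") (simp_all add: field_simps)
      then show "norm (norm ((1 / real n) *\<^sub>R L n \<omega> - c)) \<le> 1 + norm c"
        using norm_triangle_ineq4[of "(1 / real n) *\<^sub>R L n \<omega>" c] by simp
    qed
    show "(\<lambda>\<omega>. norm ((1 / real n) *\<^sub>R L n \<omega> - c)) \<in> borel_measurable M" for n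
      using L_measurable by measurable
  qed simp_all
  then show ?thesis
    using ae L_integrable by simp
qed

end
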